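(* Let $\alpha>0$. There exist constants $c_\alpha, A_\alpha, B_\alpha'>0$ depending only on $\alpha$ (and not on $d$ or $k$) such that for all $d,k\in\mathbb N$ $$A_\alpha\max(k^{-\alpha},2^{-k/d})\le e_k(\mathcal R_d^{\alpha,2},L_\infty(\Omega))\le B'_\alpha\cdot\begin{cases}1&: k\le c_\alpha d\log d,\\ k^{-\alpha}&: k\ge c_\alpha d\log d.\end{cases}$$
   Context: $\mathbb N=\{1,2,\dots\}$. $\Omega=\bar B_2^d=\{x\in\mathbb R^d:\|x\|_2\le1\}$; $\log$ is the logarithm to base 2. Lipschitz spaces: for a domain $D$ (here $D=[-1,1]$), $C^s(D)$ consists of the functions $f:D\to\mathbb R$ with bounded continuous partial derivatives up to order $s$, normed by $\|f\|_{C^s}=\max_{|\gamma|\le s}\|D^\gamma f\|_\infty$. For $0<\beta\le1$ the Hölder constant is $|f|_\beta=\sup_{x\ne y}\frac{|f(x)-f(y)|}{2\min\{1,\|x-y\|_1\}^\beta}$. For $\alpha>0$ let $s$ be the largest integer strictly less than $\alpha$ and $\beta=\alpha-s\in(0,1]$; then $\mathrm{Lip}_\alpha(D)$ is the space of $f\in C^s(D)$ with $\|f\|_{\mathrm{Lip}_\alpha(D)}=\max\{\|f\|_{C^s},\max_{|\gamma|=s}|D^\gamma f|_\beta\}<\infty$. Ridge function class: $\mathcal R_d^{\alpha,2}=\{f:\Omega\to\mathbb R:\ f(x)=g(a\cdot x),\ \|g\|_{\mathrm{Lip}_\alpha[-1,1]}\le1,\ \|a\|_2\le1\}$. Entropy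 numbers: for a subset $K$ of a (quasi-)Banach space $X$ with closed unit ball $\bar B_X$, $e_k(K,X)=\inf\{\varepsilon>0: K\subset\bigcup_{j=1}^{2^{k-1}}(x_j+\varepsilon\bar B_X)\text{ for some }x_1,\dots,x_{2^{k-1}}\in X\}$. *)

theory Defs
  imports "HOL-Probability.Essential_Supremum"
begin

text \<open>Iterated one-dimensional derivatives relative to \<^term>\<open>D\<close>, so one-sided at the end points of
  an interval. For real functions \<^const>\<open>vector_derivative\<close> is the ordinary derivative.\<close>

primrec deriv_on :: "real set \<Rightarrow> nat \<Rightarrow> (real \<Rightarrow> real) \<Rightarrow> real \<Rightarrow> real" where
  "deriv_on D 0 f = f"
| "deriv_on D (Suc n) f = (\<lambda>x. vector_derivative (deriv_on D n f) (at x within D))"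

definition C_space :: "nat \<Rightarrow> real set \<Rightarrow> (real \<Rightarrow> real) set" where
  "C_space s D = {f. (\<forall>i<s. \<forall>x\<in>D. deriv_on D i f differentiable (at x within D)) \<and>
                     (\<forall>i\<le>s. continuous_on D (deriv_on D i f) \<and> bounded (deriv_on D i f ` D))}"

text \<open>Norms take values in \<^typ>\<open>ereal\<close>, so that suprema which are not finite are \<open>\<infinity>\<close>.\<close>

definition C_norm :: "nat \<Rightarrow> real set \<Rightarrow> (real \<Rightarrow> real) \<Rightarrow> ereal" where
  "C_norm s D f = Max ((\<lambda>i. SUP x\<in>D. ereal \<bar>deriv_on D i f x\<bar>) ` {..s})"

definition holder_const :: "real \<Rightarrow> real set \<Rightarrow> (real \<Rightarrow> real) \<Rightarrow> ereal" where
  "holder_const \<beta> D f =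
     (SUP (x, y) \<in> {(x, y). x \<in> D \<and> y \<in> D \<and> x \<noteq> y}.
        ereal (\<bar>f x - f y\<bar> / (2 * (min 1 \<bar>x - y\<bar>) powr \<beta>)))"

definition lip_order :: "real \<Rightarrow> nat" where
  "lip_order \<alpha> = (GREATEST s. real s < \<alpha>)"

definition Lip_norm :: "real \<Rightarrow> real set \<Rightarrow> (real \<Rightarrow> real) \<Rightarrow> ereal" where
  "Lip_norm \<alpha> D f =
     (let s = lip_order \<alpha>
      in max (C_norm s D f) (holder_const (\<alpha> - real s) D (deriv_on D s f)))"

definition Lip_space :: "real \<Rightarrow> real set \<Rightarrow> (real \<Rightarrow> real) set" where
  "Lip_space \<alpha> D = {f \<in> C_space (lip_order \<alpha>) D. Lip_norm \<alpha> D f < \<infinity>}"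

text \<open>Since the dimension \<open>d\<close> is quantified inside the statement, the points of \<open>\<real>\<^sup>d\<close> are the
  extensional functions on the index set \<open>{..<d}\<close>, that is, the space of the product measure
  \<open>\<Pi>\<^sub>M i\<in>{..<d}. lborel\<close>.\<close>

definition unit_ball :: "nat \<Rightarrow> (nat \<Rightarrow> real) set" where
  "unit_ball d = {x \<in> {..<d} \<rightarrow>\<^sub>E UNIV. L2_set x {..<d} \<le> 1}"

definition ridge_class :: "real \<Rightarrow> nat \<Rightarrow> ((nat \<Rightarrow> real) \<Rightarrow> real) set" where
  "ridge_class \<alpha> d =
     {(\<lambda>x\<in>unit_ball d. g (\<Sum>i<d. a i * x i)) | g a.
        g \<in> Lip_space \<alpha> {-1..1} \<and> Lip_norm \<alpha> {-1..1} g \<le> 1 \<and> a \<in> unit_ball d}"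

definition ball_measure :: "nat \<Rightarrow> (nat \<Rightarrow> real) measure" where
  "ball_measure d = restrict_space (completion (\<Pi>\<^sub>M i\<in>{..<d}. lborel)) (unit_ball d)"

text \<open>Elements of \<open>L\<^sub>\<infinity>\<close> are represented by functions rather than by classes modulo null sets.\<close>

definition Linf_norm :: "'a measure \<Rightarrow> ('a \<Rightarrow> real) \<Rightarrow> ereal" where
  "Linf_norm M f = esssup M (\<lambda>x. ereal \<bar>f x\<bar>)"

definition Linf :: "'a measure \<Rightarrow> ('a \<Rightarrow> real) set" where
  "Linf M = {f \<in> borel_measurable M. Linf_norm M f < \<infinity>}"

text \<open>Here \<open>X\<close> is the carrier of a function space with (quasi-)norm \<open>nrm\<close>; the value is \<open>\<infinity>\<close> if no
  \<open>\<epsilon>\<close> is admissible. The index \<open>k\<close> is meant to be at least 1.\<close>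

definition entropy_number ::
  "nat \<Rightarrow> ('a \<Rightarrow> real) set \<Rightarrow> ('a \<Rightarrow> real) set \<Rightarrow> (('a \<Rightarrow> real) \<Rightarrow> ereal) \<Rightarrow> ereal" where
  "entropy_number k K X nrm =
     Inf (ereal ` {\<epsilon>. \<epsilon> > 0 \<and>
       (\<exists>c :: nat \<Rightarrow> 'a \<Rightarrow> real. (\<forall>j\<in>{1..2 ^ (k - 1)}. c j \<in> X) \<and>
          K \<subseteq> (\<Union>j\<in>{1..2 ^ (k - 1)}. {(\<lambda>t. c j t + \<epsilon> * b t) | b. b \<in> X \<and> nrm b \<le> 1}))})"

end

theory Submission
  imports Defs
begin

text \<open>
  The class is parametrised by pairs of a profile \<open>g\<close> and a direction \<open>a\<close>, and the entropy is governed
  by the cost of describing each of the two.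

  \<^emph>\<open>Upper bound.\<close> It is enough to assign to each pair one of \<open>2 ^ (k - 1)\<close> codes in such a way that
  functions with the same code are uniformly close (\<open>entropy_number_le_code\<close>). The profile is coded as
  by Kolmogorov and Tikhomirov, on a grid of width \<open>1 / m\<close>: Taylor's formula (\<open>jet_taylor\<close>) predicts the
  rounded derivatives at a grid point from those at the previous one up to a bounded number of units,
  and only the deviation from the prediction is recorded. This costs a bounded number of bits per grid
  point and determines the profile up to a multiple of \<open>m powr (- \<alpha>)\<close> (\<open>jet_code_close\<close>). The direction
  is rounded coordinatewise, which costs about \<open>d * log (d * m)\<close> bits (\<open>direction_code_close\<close>). If \<open>k\<close>
  is at least a large multiple of both \<open>d\<close> and \<open>d * log d\<close>, then \<open>d * log k\<close> is at most a small multiple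
  of \<open>k\<close> (\<open>dimension_cost\<close>), so \<open>m\<close> may be chosen proportional to \<open>k\<close>. In the remaining cases a
  single ball is used.

  \<^emph>\<open>Lower bounds.\<close> A ball of radius \<open>\<epsilon>\<close> cannot contain many members of a family whose members are
  mostly at distance more than \<open>2 * \<epsilon>\<close> (\<open>entropy_number_ge_multiplicity\<close>). Fixing the direction and
  adding up arbitrary subsets of \<open>k\<close> disjoint bumps gives \<open>2 ^ k\<close> functions at mutual distance of the
  order \<open>k powr (- \<alpha>)\<close>. Fixing the linear profile \<open>t / 2\<close> and letting the direction run through a
  lattice in the ball of \<open>\<real>\<^sup>d\<close> gives the term \<open>2 powr (- k / d)\<close>, since a Euclidean ball with radius
  \<open>sqrt d\<close> steps contains at most \<open>6 ^ d\<close> lattice points (\<open>lattice_points_in_ball\<close>).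

  The norm of \<open>L\<^sub>\<infinity>\<close> ignores null sets, but the functions involved are continuous and every point of the
  closed ball is a limit of boxes of positive measure in the ball (\<open>AE_ball_measure_dense\<close>), so almost
  everywhere bounds hold everywhere.
\<close>

section \<open>Entropy numbers and codes\<close>

lemma Linf_norm_le:
  assumes "f \<in> borel_measurable M" and "\<And>x. x \<in> space M \<Longrightarrow> \<bar>f x\<bar> \<le> C"
  shows "Linf_norm M f \<le> ereal C"
  unfolding Linf_norm_def
  by (rule esssup_I) (use assms in \<open>auto intro!: AE_I2 borel_measurable_ereal borel_measurable_abs\<close>)

lemma LinfI:
  assumes "f \<in> borel_measurable M" and "\<And>x. x \<in> space M \<Longrightarrow> \<bar>f x\<bar> \<le> C"
  shows "f \<in> Linf M"
  using Linf_norm_le[OF assms] assms(1) by (auto simp: Linf_def intro: order.strict_trans1)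

lemma Linf_norm_le_1D:
  assumes "Linf_norm M b \<le> 1"
  shows "AE x in M. \<bar>b x\<bar> \<le> 1"
proof -
  have "AE x in M. ereal \<bar>b x\<bar> \<le> esssup M (\<lambda>x. ereal \<bar>b x\<bar>)"
    by (rule esssup_AE)
  then show ?thesis
  proof (rule AE_mp, intro AE_I2 impI)
    fix x assume "ereal \<bar>b x\<bar> \<le> esssup M (\<lambda>x. ereal \<bar>b x\<bar>)"
    then have "ereal \<bar>b x\<bar> \<le> 1" using assms unfolding Linf_norm_def by (rule order_trans)
    then show "\<bar>b x\<bar> \<le> 1" by simp
  qed
qed

text \<open>A code with at most \<open>2 ^ (k - 1)\<close> values, whose fibres have diameter at most \<open>\<epsilon>\<close>, yields a
  covering by balls of radius \<open>\<epsilon>\<close> around one member of each fibre. The centres then belong to the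
  class itself, so they are admissible whatever rounding the code performs.\<close>

lemma entropy_number_le_code:
  fixes F :: "'i \<Rightarrow> 'a \<Rightarrow> real" and code :: "'i \<Rightarrow> 'c"
  assumes K: "K \<subseteq> F ` I" and meas: "\<And>p. p \<in> I \<Longrightarrow> F p \<in> Linf M"
    and S: "finite S" "code ` I \<subseteq> S" "card S \<le> 2 ^ (k - 1)" and "\<epsilon> > 0"
    and close: "\<And>p q x. p \<in> I \<Longrightarrow> q \<in> I \<Longrightarrow> code p = code q \<Longrightarrow> x \<in> space M \<Longrightarrow>
                  \<bar>F p x - F q x\<bar> \<le> \<epsilon>"
  shows "entropy_number k K (Linf M) (Linf_norm M) \<le> ereal \<epsilon>"
proof -
  obtain e :: "'c \<Rightarrow> nat" where e: "e ` S \<subseteq> {1..2 ^ (k - 1)}" "inj_on e S"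
    using card_le_inj[of S "{1..2 ^ (k - 1) :: nat}"] S by auto
  define rep where "rep j = (SOME p. p \<in> I \<and> e (code p) = j)" for j
  define c where "c j = (if \<exists>p\<in>I. e (code p) = j then F (rep j) else (\<lambda>_. 0))" for j
  have rep: "rep j \<in> I \<and> e (code (rep j)) = j" if "\<exists>p\<in>I. e (code p) = j" for j
    using that unfolding rep_def by (metis (mono_tags, lifting) someI_ex)
  have "(\<lambda>_. 0) \<in> Linf M" by (rule LinfI[where C=0]) auto
  then have c: "\<forall>j\<in>{1..2 ^ (k - 1)}. c j \<in> Linf M"
    unfolding c_def using rep meas by auto
  have "K \<subseteq> (\<Union>j\<in>{1..2 ^ (k - 1)}.
      {(\<lambda>t. c j t + \<epsilon> * b t) | b. b \<in> Linf M \<and> Linf_norm M b \<le> 1})"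
  proof
    fix f assume "f \<in> K"
    then obtain p where p: "p \<in> I" "f = F p" using K by auto
    define j where "j = e (code p)"
    have j: "j \<in> {1..2 ^ (k - 1)}" using e(1) S(2) p(1) unfolding j_def by blast
    have ex: "\<exists>p\<in>I. e (code p) = j" using p j_def by auto
    define q where "q = rep j"
    have q: "q \<in> I" "code q = code p"
      using rep[OF ex] e(2) S(2) p(1) unfolding q_def j_def inj_on_def by auto
    define b where "b t = (f t - F q t) / \<epsilon>" for t
    have bm: "b \<in> borel_measurable M"
      using meas[OF p(1)] meas[OF q(1)] unfolding b_def p(2) Linf_def by auto
    have b1: "\<bar>b t\<bar> \<le> 1" if "t \<in> space M" for t
      using close[OF p(1) q(1) q(2)[symmetric] that] \<open>\<epsilon> > 0\<close> by (simp add: b_def p(2))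
    have "Linf_norm M b \<le> 1" using Linf_norm_le[OF bm b1] by (simp add: one_ereal_def)
    moreover have "b \<in> Linf M" by (rule LinfI[OF bm b1])
    moreover have "f = (\<lambda>t. c j t + \<epsilon> * b t)"
      using ex \<open>\<epsilon> > 0\<close> by (simp add: c_def b_def q_def)
    ultimately show "f \<in> (\<Union>j\<in>{1..2 ^ (k - 1)}.
      {(\<lambda>t. c j t + \<epsilon> * b t) | b. b \<in> Linf M \<and> Linf_norm M b \<le> 1})"
      using j by blast
  qed
  then show ?thesis
    unfolding entropy_number_def using c \<open>\<epsilon> > 0\<close>
    by (intro Inf_lower imageI CollectI conjI exI[of _ c]) auto
qed

text \<open>Conversely, a ball of radius \<open>\<epsilon>\<close> contains only functions at distance at most \<open>2 * \<epsilon>\<close> of each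
  other, so at most \<open>m\<close> members of the finite family. Allowing \<open>m > 1\<close> makes it possible to use a
  lattice as test family, without thinning it out to a separated set.\<close>

lemma entropy_number_ge_multiplicity:
  fixes F :: "'i \<Rightarrow> 'a \<Rightarrow> real"
  assumes I: "finite I" "F ` I \<subseteq> K" and "\<eta> \<ge> 0"
    and near: "\<And>p q \<epsilon>. p \<in> I \<Longrightarrow> q \<in> I \<Longrightarrow> \<epsilon> < \<eta> \<Longrightarrow> AE x in M. \<bar>F p x - F q x\<bar> \<le> 2 * \<epsilon> \<Longrightarrow>
                 near p q"
    and mult: "\<And>p. p \<in> I \<Longrightarrow> card {q \<in> I. near p q} \<le> m"
    and large: "2 ^ (k - 1) * m < card I"
  shows "ereal \<eta> \<le> entropy_number k K (Linf M) (Linf_norm M)"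
  unfolding entropy_number_def
proof (rule Inf_greatest, elim imageE, clarify)
  fix \<epsilon> :: real and c :: "nat \<Rightarrow> 'a \<Rightarrow> real"
  assume "\<epsilon> > 0" and c: "\<forall>j\<in>{1..2 ^ (k - 1)}. c j \<in> Linf M"
    and cov: "K \<subseteq> (\<Union>j\<in>{1..2 ^ (k - 1)}.
      {(\<lambda>t. c j t + \<epsilon> * b t) | b. b \<in> Linf M \<and> Linf_norm M b \<le> 1})"
  show "ereal \<eta> \<le> ereal \<epsilon>"
  proof (rule ccontr)
    assume "\<not> ereal \<eta> \<le> ereal \<epsilon>"
    then have "\<epsilon> < \<eta>" by simp
    define B where "B j = {p \<in> I. \<exists>b. F p = (\<lambda>t. c j t + \<epsilon> * b t) \<and> Linf_norm M b \<le> 1}" for j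
    have I_B: "I \<subseteq> (\<Union>j\<in>{1..2 ^ (k - 1)}. B j)"
    proof
      fix p assume "p \<in> I"
      then have "F p \<in> (\<Union>j\<in>{1..2 ^ (k - 1)}.
          {(\<lambda>t. c j t + \<epsilon> * b t) | b. b \<in> Linf M \<and> Linf_norm M b \<le> 1})"
        using I(2) cov by blast
      then show "p \<in> (\<Union>j\<in>{1..2 ^ (k - 1)}. B j)" using \<open>p \<in> I\<close> unfolding B_def by blast
    qed
    have B_fin: "finite (B j)" for j unfolding B_def using I(1) by auto
    have B_card: "card (B j) \<le> m" for j
    proof (cases "B j = {}")
      case False
      then obtain p where p: "p \<in> B j" by auto
      have "B j \<subseteq> {q \<in> I. near p q}"
      proof
        fix q assume q: "q \<in> B j"
        obtain b b' where b: "F p = (\<lambda>t. c j t + \<epsilon> * b t)" "Linf_norm M b \<le> 1"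
            and b': "F q = (\<lambda>t. c j t + \<epsilon> * b' t)" "Linf_norm M b' \<le> 1"
          using p q unfolding B_def by blast
        have "AE x in M. \<bar>F p x - F q x\<bar> \<le> 2 * \<epsilon>"
          using Linf_norm_le_1D[OF b(2)] Linf_norm_le_1D[OF b'(2)]
        proof eventually_elim
          case (elim x)
          have "\<bar>F p x - F q x\<bar> = \<epsilon> * \<bar>b x - b' x\<bar>"
            using \<open>\<epsilon> > 0\<close> by (simp add: b(1) b'(1) abs_mult flip: right_diff_distrib)
          also have "\<dots> \<le> \<epsilon> * 2" using elim \<open>\<epsilon> > 0\<close> by (intro mult_left_mono) auto
          finally show ?case by simp
        qed
        then show "q \<in> {q \<in> I. near p q}"
          using p q near[of p q \<epsilon>] \<open>\<epsilon> < \<eta>\<close> unfolding B_def by auto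
      qed
      then have "card (B j) \<le> card {q \<in> I. near p q}" using I(1) by (intro card_mono) auto
      then show ?thesis using mult[of p] p unfolding B_def by auto
    qed simp
    have "card I \<le> card (\<Union>j\<in>{1..2 ^ (k - 1)}. B j)"
      using I_B B_fin by (intro card_mono) auto
    also have "\<dots> \<le> (\<Sum>j\<in>{1..2 ^ (k - 1) :: nat}. card (B j))"
      by (rule card_UN_le) simp
    also have "\<dots> \<le> (\<Sum>j\<in>{1..2 ^ (k - 1) :: nat}. m)"
      by (rule sum_mono) (rule B_card)
    finally have "card I \<le> 2 ^ (k - 1) * m" by simp
    with large show False by simp
  qed
qed

section \<open>The measure on the ball\<close>

interpretation lborel_product: product_sigma_finite "\<lambda>_ :: nat. lborel :: real measure"
  by standard

lemma sets_unit_ball: "unit_ball d \<in> sets (\<Pi>\<^sub>M i\<in>{..<d}. lborel)"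
proof -
  have "unit_ball d = {x \<in> space (\<Pi>\<^sub>M i\<in>{..<d}. lborel). sqrt (\<Sum>i<d. (x i)\<^sup>2) \<le> 1}"
    by (auto simp: unit_ball_def L2_set_def space_PiM)
  also have "\<dots> \<in> sets (\<Pi>\<^sub>M i\<in>{..<d}. lborel)" by measurable
  finally show ?thesis .
qed

lemma space_ball_measure [simp]: "space (ball_measure d) = unit_ball d"
  by (auto simp: ball_measure_def space_restrict_space unit_ball_def space_PiM)

lemma AE_ball_measure:
  "(AE x in ball_measure d. P x) \<longleftrightarrow> (AE x in (\<Pi>\<^sub>M i\<in>{..<d}. lborel). x \<in> unit_ball d \<longrightarrow> P x)"
proof -
  have "unit_ball d \<inter> space (completion (\<Pi>\<^sub>M i\<in>{..<d}. lborel))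
          \<in> sets (completion (\<Pi>\<^sub>M i\<in>{..<d}. lborel))"
    using sets_unit_ball[of d] by (metis sets.Int_space_eq2 sets_completionI_sets)
  then show ?thesis
    unfolding ball_measure_def by (simp add: AE_restrict_space_iff AE_completion_iff)
qed

lemma L2_set_scale: "L2_set (\<lambda>i. c * f i) A = \<bar>c\<bar> * L2_set f A"
  by (simp add: L2_set_def power_mult_distrib sum_nonneg real_sqrt_mult flip: sum_distrib_left)

lemma unit_ball_coordinate:
  assumes "x \<in> unit_ball d" "i < d"
  shows "\<bar>x i\<bar> \<le> 1"
proof -
  have "\<bar>x i\<bar> \<le> L2_set (\<lambda>i. \<bar>x i\<bar>) {..<d}" using assms(2) by (intro member_le_L2_set) auto
  also have "\<dots> \<le> 1" using assms(1) by (simp add: unit_ball_def L2_set_def)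
  finally show ?thesis .
qed

lemma abs_inner_le_L2: "\<bar>\<Sum>i\<in>A. a i * x i\<bar> \<le> L2_set a A * L2_set x A"
proof -
  have "\<bar>\<Sum>i\<in>A. a i * x i\<bar> \<le> (\<Sum>i\<in>A. \<bar>a i\<bar> * \<bar>x i\<bar>)"
    using sum_abs[of "\<lambda>i. a i * x i" A] by (simp add: abs_mult)
  then show ?thesis using L2_set_mult_ineq[of a x A] by linarith
qed

lemma inner_unit_ball:
  assumes "a \<in> unit_ball d" "x \<in> unit_ball d"
  shows "(\<Sum>i<d. a i * x i) \<in> {-1..1}"
proof -
  have "L2_set a {..<d} * L2_set x {..<d} \<le> 1 * 1"
    using assms by (intro mult_mono) (auto simp: unit_ball_def)
  then show ?thesis using abs_inner_le_L2[of a x "{..<d}"] by auto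
qed

text \<open>Every point of the ball, even on the sphere, is a limit of small boxes inside the ball: shrink it
  towards the origin first. The boxes have positive measure, so a property that holds almost
  everywhere holds at points arbitrarily close to any given one.\<close>

lemma AE_ball_measure_dense:
  assumes AE: "AE x in ball_measure d. P x" and x: "x \<in> unit_ball d" and "\<rho> > 0"
  shows "\<exists>y\<in>unit_ball d. (\<forall>i<d. \<bar>y i - x i\<bar> < \<rho>) \<and> P y"
proof -
  define \<tau> where "\<tau> = min 1 (\<rho> / 2)"
  define h where "h = \<tau> / (2 * (real d + 1))"
  have \<tau>: "0 < \<tau>" "\<tau> \<le> 1" "\<tau> \<le> \<rho> / 2" using \<open>\<rho> > 0\<close> by (auto simp: \<tau>_def)
  have h: "h > 0" "real d * h \<le> \<tau>" "h < \<rho> / 2"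
  proof -
    show "h > 0" using \<tau> by (simp add: h_def)
    have "real d * \<tau> \<le> \<tau> * (2 * (real d + 1))" using \<tau> by (simp add: algebra_simps)
    then show "real d * h \<le> \<tau>" by (simp add: h_def divide_simps)
    have "0 \<le> \<rho> * real d" using \<open>\<rho> > 0\<close> by simp
    moreover have "\<rho> / 2 * (2 * (real d + 1)) = \<rho> + \<rho> * real d" by (simp add: algebra_simps)
    ultimately have "\<tau> < \<rho> / 2 * (2 * (real d + 1))" using \<tau> \<open>\<rho> > 0\<close> by linarith
    then show "h < \<rho> / 2" by (simp add: h_def divide_simps)
  qed
  define box where "box = (\<Pi>\<^sub>E i\<in>{..<d}. {(1 - \<tau>) * x i - h..(1 - \<tau>) * x i + h})"
  have near: "\<bar>y i - (1 - \<tau>) * x i\<bar> \<le> h" if "y \<in> box" "i < d" for y i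
    using PiE_mem[OF that(1)[unfolded box_def], of i] that(2) by (auto simp: abs_le_iff)
  have box_ball: "y \<in> unit_ball d" if y: "y \<in> box" for y
  proof -
    have "L2_set y {..<d} = L2_set (\<lambda>i. (1 - \<tau>) * x i + (y i - (1 - \<tau>) * x i)) {..<d}"
      by simp
    also have "\<dots> \<le> L2_set (\<lambda>i. (1 - \<tau>) * x i) {..<d} + L2_set (\<lambda>i. y i - (1 - \<tau>) * x i) {..<d}"
      by (rule L2_set_triangle_ineq)
    also have "L2_set (\<lambda>i. (1 - \<tau>) * x i) {..<d} \<le> 1 - \<tau>"
      using x \<tau> by (simp add: L2_set_scale unit_ball_def mult_left_le)
    also have "L2_set (\<lambda>i. y i - (1 - \<tau>) * x i) {..<d} \<le> (\<Sum>i<d. \<bar>y i - (1 - \<tau>) * x i\<bar>)"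
      by (rule L2_set_le_sum_abs)
    also have "\<dots> \<le> (\<Sum>i<d. h)" using near[OF y] by (intro sum_mono) auto
    finally have "L2_set y {..<d} \<le> 1" using h by simp
    then show ?thesis using y unfolding unit_ball_def box_def by (auto simp: PiE_iff)
  qed
  have "emeasure (\<Pi>\<^sub>M i\<in>{..<d}. lborel) box = (\<Prod>i\<in>{..<d}. ennreal (2 * h))"
    unfolding box_def using h(1) by (subst lborel_product.emeasure_PiM) (auto intro!: prod.cong)
  then have pos: "emeasure (\<Pi>\<^sub>M i\<in>{..<d}. lborel) box \<noteq> 0"
    using h(1) by (simp add: prod_zero_iff)
  have "\<exists>y\<in>box. P y"
  proof (rule ccontr)
    assume no: "\<not> (\<exists>y\<in>box. P y)"
    have AE_box: "AE y in (\<Pi>\<^sub>M i\<in>{..<d}. lborel). y \<notin> box"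
      using AE unfolding AE_ball_measure by eventually_elim (use no box_ball in auto)
    have sets: "box \<in> sets (\<Pi>\<^sub>M i\<in>{..<d}. lborel)"
      unfolding box_def by (intro sets_PiM_I_finite) auto
    have "{y \<in> space (\<Pi>\<^sub>M i\<in>{..<d}. lborel). \<not> y \<notin> box} = box"
      using sets.sets_into_space[OF sets] by blast
    then have "emeasure (\<Pi>\<^sub>M i\<in>{..<d}. lborel) box = 0"
      using AE_iff_measurable[OF sets, of "\<lambda>y. y \<notin> box"] AE_box by metis
    with pos show False ..
  qed
  then obtain y where y: "y \<in> box" "P y" by auto
  have "\<bar>y i - x i\<bar> < \<rho>" if "i < d" for i
  proof -
    have "\<bar>\<tau> * x i\<bar> \<le> \<tau>" using unit_ball_coordinate[OF x that] \<tau> by (simp add: abs_mult mult_left_le)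
    then show ?thesis using near[OF y(1) that] h(3) \<tau>(3) by (simp add: algebra_simps)
  qed
  then show ?thesis using y box_ball by auto
qed

section \<open>Jets of functions in the unit ball of the Lipschitz space\<close>

text \<open>\<open>lip_jet s \<beta> G\<close> says that \<open>G 0, \<dots>, G s\<close> are the successive derivatives of a function of norm at
  most one in \<open>Lip\<^sub>\<alpha>[-1,1]\<close> with \<open>\<alpha> = s + \<beta>\<close>. It separates the analysis from
  \<^const>\<open>deriv_on\<close>, whose iterates are only determined on the interval.\<close>

definition lip_jet :: "nat \<Rightarrow> real \<Rightarrow> (nat \<Rightarrow> real \<Rightarrow> real) \<Rightarrow> bool" where
  "lip_jet s \<beta> G \<longleftrightarrow>
     (\<forall>i<s. \<forall>x\<in>{-1..1}. (G i has_vector_derivative G (Suc i) x) (at x within {-1..1})) \<and>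
     (\<forall>i\<le>s. \<forall>x\<in>{-1..1}. \<bar>G i x\<bar> \<le> 1) \<and>
     (\<forall>x\<in>{-1..1}. \<forall>y\<in>{-1..1}. \<bar>G s x - G s y\<bar> \<le> 2 * min 1 \<bar>x - y\<bar> powr \<beta>)"

lemma lip_order:
  assumes "\<alpha> > 0"
  shows "real (lip_order \<alpha>) < \<alpha>" "\<alpha> \<le> real (lip_order \<alpha>) + 1"
proof -
  have bd: "\<forall>y. real y < \<alpha> \<longrightarrow> y \<le> nat \<lceil>\<alpha>\<rceil>" by (auto, linarith)
  show "real (lip_order \<alpha>) < \<alpha>"
    unfolding lip_order_def by (rule GreatestI_nat[of "\<lambda>s. real s < \<alpha>" 0, OF _ bd[rule_format]]) (use assms in auto)
  show "\<alpha> \<le> real (lip_order \<alpha>) + 1"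
  proof (rule ccontr)
    assume "\<not> ?thesis"
    then have "Suc (lip_order \<alpha>) \<le> lip_order \<alpha>"
      unfolding lip_order_def by (intro Greatest_le_nat[OF _ bd[rule_format]]) auto
    then show False by simp
  qed
qed

lemma SUP_ereal_le_1_iff: "(SUP x\<in>D. ereal (h x)) \<le> 1 \<longleftrightarrow> (\<forall>x\<in>D. h x \<le> 1)"
  unfolding SUP_le_iff one_ereal_def by simp

lemma C_norm_le_1_iff: "C_norm s D f \<le> 1 \<longleftrightarrow> (\<forall>i\<le>s. \<forall>x\<in>D. \<bar>deriv_on D i f x\<bar> \<le> 1)"
  unfolding C_norm_def by (subst Max_le_iff) (auto simp: SUP_ereal_le_1_iff)

lemma holder_const_le_1_iff:
  "holder_const \<beta> D f \<le> 1 \<longleftrightarrow>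
     (\<forall>x\<in>D. \<forall>y\<in>D. \<bar>f x - f y\<bar> \<le> 2 * min 1 \<bar>x - y\<bar> powr \<beta>)"
proof -
  have iff: "\<bar>f x - f y\<bar> / (2 * min 1 \<bar>x - y\<bar> powr \<beta>) \<le> 1 \<longleftrightarrow> \<bar>f x - f y\<bar> \<le> 2 * min 1 \<bar>x - y\<bar> powr \<beta>"
    if "x \<noteq> y" for x y
    using that by (subst divide_le_eq_1_pos) (auto simp: min_def)
  have "holder_const \<beta> D f \<le> 1 \<longleftrightarrow>
     (\<forall>x\<in>D. \<forall>y\<in>D. x \<noteq> y \<longrightarrow> \<bar>f x - f y\<bar> \<le> 2 * min 1 \<bar>x - y\<bar> powr \<beta>)"
    unfolding holder_const_def SUP_le_iff one_ereal_def
    by (auto simp: iff)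
  also have "\<dots> \<longleftrightarrow> (\<forall>x\<in>D. \<forall>y\<in>D. \<bar>f x - f y\<bar> \<le> 2 * min 1 \<bar>x - y\<bar> powr \<beta>)"
    by (metis abs_zero diff_self mult_nonneg_nonneg powr_ge_zero zero_le_numeral)
  finally show ?thesis .
qed

lemma Lip_unit_ball_jet:
  assumes "g \<in> Lip_space \<alpha> {-1..1}" "Lip_norm \<alpha> {-1..1} g \<le> 1"
  shows "lip_jet (lip_order \<alpha>) (\<alpha> - lip_order \<alpha>) (\<lambda>i. deriv_on {-1..1} i g)"
  using assms vector_derivative_works
  unfolding lip_jet_def Lip_space_def Lip_norm_def C_space_def Let_def
  by (auto simp: C_norm_le_1_iff holder_const_le_1_iff simp del: min_def)

lemma jet_deriv_on:
  assumes "lip_jet s \<beta> G" "i \<le> s" "x \<in> {-1..1}"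
  shows "deriv_on {-1..1} i (G 0) x = G i x"
  using assms(2,3)
proof (induction i arbitrary: x)
  case (Suc i)
  have "(G i has_vector_derivative G (Suc i) x) (at x within {-1..1})"
    using assms(1) Suc.prems unfolding lip_jet_def by auto
  then have "(deriv_on {-1..1} i (G 0) has_vector_derivative G (Suc i) x) (at x within {-1..1})"
    by (rule has_vector_derivative_transform[OF Suc.prems(2), rotated])
      (rule Suc.IH; use Suc.prems in simp)
  then show ?case using Suc.prems
    by (simp add: vector_derivative_within_closed_interval)
qed simp

lemma jet_continuous:
  assumes "lip_jet s \<beta> G" "\<beta> > 0" "i \<le> s"
  shows "continuous_on {-1..1} (G i)"
proof (cases "i < s")
  case True
  then have "(G i has_vector_derivative G (Suc i) x) (at x within {-1..1})" if "x \<in> {-1..1}" for x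
    using assms(1) that unfolding lip_jet_def by blast
  then show ?thesis by (rule continuous_on_vector_derivative)
next
  case False
  then have "i = s" using assms(3) by simp
  show ?thesis unfolding \<open>i = s\<close> continuous_on_def
  proof
    fix x :: real assume x: "x \<in> {-1..1}"
    have "((\<lambda>y. 2 * \<bar>y - x\<bar> powr \<beta>) \<longlongrightarrow> 2 * \<bar>x - x\<bar> powr \<beta>) (at x within {-1..1})"
      using assms(2) by (intro tendsto_intros) auto
    then have lim: "((\<lambda>y. 2 * \<bar>y - x\<bar> powr \<beta>) \<longlongrightarrow> 0) (at x within {-1..1})" by simp
    have "norm (G s y - G s x) \<le> 2 * \<bar>y - x\<bar> powr \<beta>" if "y \<in> {-1..1}" for y
    proof -
      have "\<bar>G s y - G s x\<bar> \<le> 2 * min 1 \<bar>y - x\<bar> powr \<beta>"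
        using assms(1) x that unfolding lip_jet_def by blast
      moreover have "min 1 \<bar>y - x\<bar> powr \<beta> \<le> \<bar>y - x\<bar> powr \<beta>"
        using assms(2) by (intro powr_mono2) auto
      ultimately show ?thesis by simp
    qed
    then have "((\<lambda>y. G s y - G s x) \<longlongrightarrow> 0) (at x within {-1..1})"
      by (intro Lim_null_comparison[OF _ lim]) (auto simp: eventually_at_filter)
    then show "(G s \<longlongrightarrow> G s x) (at x within {-1..1})"
      using LIM_zero_iff by blast
  qed
qed

lemma jet_Lip_unit_ball:
  assumes jet: "lip_jet (lip_order \<alpha>) (\<alpha> - lip_order \<alpha>) G" and "\<alpha> > 0"
  shows "G 0 \<in> Lip_space \<alpha> {-1..1}" "Lip_norm \<alpha> {-1..1} (G 0) \<le> 1"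
proof -
  define s where "s = lip_order \<alpha>"
  have J: "lip_jet s (\<alpha> - s) G" and \<beta>: "\<alpha> - s > 0"
    using jet lip_order[OF assms(2)] by (auto simp: s_def)
  note D = jet_deriv_on[OF J]
  have C: "G 0 \<in> C_space s {-1..1}"
    unfolding C_space_def
  proof (intro CollectI conjI allI impI ballI)
    fix i and x :: real assume "i < s" "x \<in> {-1..1}"
    then have "(G i has_vector_derivative G (Suc i) x) (at x within {-1..1})"
      using J unfolding lip_jet_def by auto
    then have "(deriv_on {-1..1} i (G 0) has_vector_derivative G (Suc i) x) (at x within {-1..1})"
      by (rule has_vector_derivative_transform[OF \<open>x \<in> _\<close>, rotated])
        (rule D; use \<open>i < s\<close> in simp)
    then show "deriv_on {-1..1} i (G 0) differentiable at x within {-1..1}"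
      by (auto simp: differentiable_def has_vector_derivative_def)
  next
    fix i assume "i \<le> s"
    show "continuous_on {-1..1} (deriv_on {-1..1} i (G 0))"
      using continuous_on_cong[OF refl D[OF \<open>i \<le> s\<close>], of "{-1..1}" "\<lambda>x. x"]
        jet_continuous[OF J \<beta> \<open>i \<le> s\<close>] by simp
    show "bounded (deriv_on {-1..1} i (G 0) ` {-1..1})"
      using J D \<open>i \<le> s\<close> unfolding lip_jet_def by (intro boundedI[of _ 1]) auto
  qed
  show N: "Lip_norm \<alpha> {-1..1} (G 0) \<le> 1"
    using J D unfolding Lip_norm_def Let_def lip_jet_def s_def[symmetric]
    by (auto simp: C_norm_le_1_iff holder_const_le_1_iff)
  show "G 0 \<in> Lip_space \<alpha> {-1..1}"
    using C N unfolding Lip_space_def s_def by (auto intro: order.strict_trans1)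
qed

text \<open>Taylor's formula with a Hoelder remainder, simultaneously for all derivatives. The remainder of
  order \<open>i\<close> has the remainder of order \<open>i + 1\<close> as its derivative, so the mean value theorem gains one
  power of the step width at a time, starting from the Hoelder condition on the last derivative.\<close>

lemma jet_taylor:
  assumes jet: "lip_jet s \<beta> G" and \<beta>: "\<beta> > 0" and x: "-1 \<le> x" and "i + n = s"
    and "x \<le> y" "y \<le> 1" "y - x \<le> 1"
  shows "\<bar>G i y - (\<Sum>l\<le>n. G (i + l) x * (y - x) ^ l / fact l)\<bar> \<le> 2 * (y - x) powr (n + \<beta>)"
  using assms(4-)
proof (induction n arbitrary: i y)
  case 0
  have "x \<in> {-1..1}" "y \<in> {-1..1}" using x 0 by auto
  then have "\<bar>G s y - G s x\<bar> \<le> 2 * min 1 \<bar>y - x\<bar> powr \<beta>"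
    using jet unfolding lip_jet_def by blast
  then show ?case using 0 by simp
next
  case (Suc n)
  define R where "R u = G i u - (\<Sum>l\<le>Suc n. G (i + l) x * (u - x) ^ l / fact l)" for u
  define R' where "R' u = G (Suc i) u - (\<Sum>l\<le>n. G (Suc i + l) x * (u - x) ^ l / fact l)" for u
  have R_eq: "R u = G i u - (G i x + (\<Sum>l\<le>n. G (Suc i + l) x * ((u - x) ^ Suc l / fact (Suc l))))" for u
    unfolding R_def by (subst sum.atMost_Suc_shift) simp
  have deriv: "(R has_derivative (*) (R' u)) (at u within {x..y})" if u: "x \<le> u" "u \<le> y" for u
  proof -
    have "(G i has_vector_derivative G (Suc i) u) (at u within {-1..1})"
      using jet Suc.prems x u unfolding lip_jet_def by auto
    then have Gi: "(G i has_real_derivative G (Suc i) u) (at u within {x..y})"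
      using x Suc.prems unfolding has_real_derivative_iff_has_vector_derivative
      by (elim has_vector_derivative_within_subset) auto
    have mono: "((\<lambda>u. (u - x) ^ Suc l / fact (Suc l)) has_real_derivative (u - x) ^ l / fact l)
            (at u within {x..y})" for l
    proof -
      have "((\<lambda>u. (u - x) ^ Suc l) has_real_derivative real (Suc l) * (u - x) ^ l) (at u within {x..y})"
        by (rule derivative_eq_intros refl | simp)+
      from DERIV_cdivide[OF this, of "fact (Suc l)"]
      show ?thesis by (simp only: fact_Suc of_nat_mult of_nat_fact) (simp add: divide_simps del: of_nat_Suc)
    qed
    have sum: "((\<lambda>u. \<Sum>l\<le>n. G (Suc i + l) x * ((u - x) ^ Suc l / fact (Suc l))) has_real_derivative
            (\<Sum>l\<le>n. G (Suc i + l) x * ((u - x) ^ l / fact l))) (at u within {x..y})"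
      by (rule DERIV_sum, rule DERIV_cmult, rule mono)
    have "(R has_real_derivative (G (Suc i) u - (0 + (\<Sum>l\<le>n. G (Suc i + l) x * ((u - x) ^ l / fact l)))))
            (at u within {x..y})"
      unfolding R_eq[abs_def]
      by (rule DERIV_diff[OF Gi DERIV_add[OF DERIV_const sum]])
    then show ?thesis by (simp add: R'_def has_field_derivative_def)
  qed
  obtain u where u: "u \<in> {x..y}" "R y - R x = R' u * (y - x)"
    using mvt_very_simple[OF Suc.prems(2), of R "\<lambda>u. (*) (R' u)"] deriv by blast
  have "R x = 0" unfolding R_eq by simp
  have "\<bar>R' u\<bar> \<le> 2 * (u - x) powr (n + \<beta>)"
    unfolding R'_def using u Suc.prems by (intro Suc.IH) auto
  also have "\<dots> \<le> 2 * (y - x) powr (n + \<beta>)"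
    using u \<beta> by (intro mult_left_mono powr_mono2) auto
  finally have "\<bar>R' u\<bar> * (y - x) \<le> 2 * (y - x) powr (n + \<beta>) * (y - x)"
    using Suc.prems by (intro mult_right_mono) auto
  then have "\<bar>R y\<bar> \<le> 2 * (y - x) powr (n + \<beta>) * (y - x)"
    using u Suc.prems \<open>R x = 0\<close> by (simp add: abs_mult)
  also have "\<dots> = 2 * (y - x) powr (Suc n + \<beta>)"
    using Suc.prems(2) powr_add[of "y - x" 1 "n + \<beta>"] by (simp add: algebra_simps)
  finally show ?case unfolding R_def .
qed

text \<open>The error of the direction enters through the modulus of continuity of the profile, which is
  Hoelder continuous for \<open>s = 0\<close> and Lipschitz otherwise. An accuracy of \<open>\<delta> ^ Suc s\<close> is sufficient in
  both cases, and with a natural exponent it can be matched by rounding to multiples of \<open>1 / N\<close>, \<open>N\<close> an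
  integer.\<close>

lemma jet_modulus:
  assumes jet: "lip_jet s \<beta> G" and \<beta>: "0 < \<beta>" "\<beta> \<le> 1" and "u \<in> {-1..1}" "v \<in> {-1..1}"
    and "\<bar>u - v\<bar> \<le> \<delta> ^ Suc s" "0 < \<delta>" "\<delta> \<le> 1"
  shows "\<bar>G 0 u - G 0 v\<bar> \<le> 2 * \<delta> powr (s + \<beta>)"
proof (cases s)
  case 0
  have "\<bar>G 0 u - G 0 v\<bar> \<le> 2 * min 1 \<bar>u - v\<bar> powr \<beta>"
    using jet assms(4,5) unfolding lip_jet_def 0 by auto
  also have "\<dots> \<le> 2 * \<delta> powr \<beta>"
    using assms 0 by (intro mult_left_mono powr_mono2) auto
  finally show ?thesis using 0 by simp
next
  case (Suc n)
  have le: "\<bar>G 0 u - G 0 v\<bar> \<le> \<bar>u - v\<bar>"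
    using field_differentiable_bound[of "{-1..1}" "G 0" "G 1" 1 u v] jet Suc assms(4,5)
    unfolding lip_jet_def has_real_derivative_iff_has_vector_derivative[symmetric]
    by (auto simp: abs_minus_commute)
  also have "\<dots> \<le> \<delta> powr (Suc s)" using assms by (subst powr_realpow) auto
  also have "\<dots> \<le> \<delta> powr (s + \<beta>)" using assms by (intro powr_mono') auto
  finally show ?thesis by simp
qed

section \<open>Coding a jet by its rounded increments\<close>

text \<open>The derivatives at the grid point \<open>-1 + j / m\<close>, each in units of the accuracy at which it has
  to be known: the derivative of order \<open>i\<close> enters Taylor's formula with the factor \<open>m powr (-i)\<close>, so
  an error \<open>m powr (i - (s + \<beta>))\<close> in it is harmless.\<close>

definition jet_sample :: "nat \<Rightarrow> real \<Rightarrow> nat \<Rightarrow> (nat \<Rightarrow> real \<Rightarrow> real) \<Rightarrow> nat \<Rightarrow> nat \<Rightarrow> real" where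
  "jet_sample s \<beta> m G j i = G i (-1 + real j / real m) * real m powr (s + \<beta> - i)"

text \<open>Taylor's formula for a step of one grid point: in these units the step width is one.\<close>

definition taylor_shift :: "nat \<Rightarrow> (nat \<Rightarrow> real) \<Rightarrow> nat \<Rightarrow> real" where
  "taylor_shift s v i = (\<Sum>l\<le>s - i. v (i + l) / fact l)"

lemma jet_sample_step:
  assumes jet: "lip_jet s \<beta> G" and \<beta>: "\<beta> > 0" and m: "m > 0" and j: "j < 2 * m" and i: "i \<le> s"
  shows "\<bar>jet_sample s \<beta> m G (Suc j) i - taylor_shift s (jet_sample s \<beta> m G j) i\<bar> \<le> 2"
proof -
  define x y where "x = -1 + real j / real m" and "y = -1 + real (Suc j) / real m"
  define w where "w = real m powr (s + \<beta> - i)"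
  have yx: "y - x = 1 / real m" using m by (simp add: x_def y_def field_simps)
  have "real (Suc j) \<le> 2 * real m" using j by linarith
  then have "-1 \<le> x" "x \<le> y" "y \<le> 1" "y - x \<le> 1"
    using m yx by (auto simp: x_def y_def field_simps)
  then have T: "\<bar>G i y - (\<Sum>l\<le>s - i. G (i + l) x * (y - x) ^ l / fact l)\<bar>
      \<le> 2 * (y - x) powr (real (s - i) + \<beta>)"
    using i by (intro jet_taylor[OF jet \<beta>]) auto
  have w: "w > 0" using m by (simp add: w_def)
  have unit: "(y - x) powr (real (s - i) + \<beta>) * w = 1"
    using m i by (simp add: yx w_def powr_divide of_nat_diff algebra_simps)
  have "G (i + l) x * (y - x) ^ l / fact l * w = jet_sample s \<beta> m G j (i + l) / fact l" for l
  proof -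
    have "w = real m powr (s + \<beta> - (i + l)) * real m ^ l"
      using m powr_add[of "real m" "s + \<beta> - (i + l)" "real l"]
      by (simp add: w_def powr_realpow add_diff_eq)
    then show ?thesis
      using m unfolding yx by (simp add: jet_sample_def x_def power_divide)
  qed
  then have "(\<Sum>l\<le>s - i. G (i + l) x * (y - x) ^ l / fact l) * w = taylor_shift s (jet_sample s \<beta> m G j) i"
    unfolding taylor_shift_def sum_distrib_right by simp
  moreover have "jet_sample s \<beta> m G (Suc j) i = G i y * w"
    by (simp add: jet_sample_def y_def w_def)
  ultimately have "jet_sample s \<beta> m G (Suc j) i - taylor_shift s (jet_sample s \<beta> m G j) i
      = (G i y - (\<Sum>l\<le>s - i. G (i + l) x * (y - x) ^ l / fact l)) * w"
    by (simp add: left_diff_distrib)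
  then have "\<bar>jet_sample s \<beta> m G (Suc j) i - taylor_shift s (jet_sample s \<beta> m G j) i\<bar>
      = \<bar>G i y - (\<Sum>l\<le>s - i. G (i + l) x * (y - x) ^ l / fact l)\<bar> * w"
    using w by (simp only: abs_mult abs_of_pos)
  also have "\<dots> \<le> 2 * (y - x) powr (real (s - i) + \<beta>) * w"
    using T w by (intro mult_right_mono) auto
  also have "\<dots> = 2" using unit by simp
  finally show ?thesis .
qed

lemma taylor_shift_floor:
  assumes "i \<le> s"
  shows "\<bar>taylor_shift s v i - taylor_shift s (\<lambda>l. of_int \<lfloor>v l\<rfloor>) i\<bar> \<le> real s + 1"
proof -
  have "\<bar>taylor_shift s v i - taylor_shift s (\<lambda>l. of_int \<lfloor>v l\<rfloor>) i\<bar>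
      = \<bar>\<Sum>l\<le>s - i. frac (v (i + l)) / fact l\<bar>"
    by (simp add: taylor_shift_def frac_def diff_divide_distrib flip: sum_subtractf)
  also have "\<dots> \<le> (\<Sum>l\<le>s - i. 1)"
  proof (intro order.trans[OF sum_abs] sum_mono)
    fix l
    have "frac (v (i + l)) \<le> 1" using frac_lt_1[of "v (i + l)"] by simp
    moreover have "(1::real) \<le> fact l" by simp
    ultimately have "frac (v (i + l)) \<le> fact l" by (rule order_trans)
    then show "\<bar>frac (v (i + l)) / fact l\<bar> \<le> 1" by (simp add: frac_ge_0)
  qed
  also have "\<dots> \<le> real s + 1" by simp
  finally show ?thesis .
qed

text \<open>The code consists of the rounded samples at the left end point, and of the errors made when the
  next rounded sample is predicted by Taylor's formula from the current one. Each error takes a number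
  of values that depends on \<open>s\<close> only; rounding the samples themselves would cost a factor
  \<open>log m\<close> in the exponent.\<close>

definition jet_increment :: "nat \<Rightarrow> real \<Rightarrow> nat \<Rightarrow> (nat \<Rightarrow> real \<Rightarrow> real) \<Rightarrow> nat \<Rightarrow> nat \<Rightarrow> int" where
  "jet_increment s \<beta> m G j i =
     \<lfloor>jet_sample s \<beta> m G (Suc j) i\<rfloor> -
     \<lfloor>taylor_shift s (\<lambda>l. of_int \<lfloor>jet_sample s \<beta> m G j l\<rfloor>) i\<rfloor>"

definition jet_code ::
  "nat \<Rightarrow> real \<Rightarrow> nat \<Rightarrow> (nat \<Rightarrow> real \<Rightarrow> real) \<Rightarrow> (nat \<Rightarrow> int) \<times> (nat \<times> nat \<Rightarrow> int)" where
  "jet_code s \<beta> m G =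
     (\<lambda>i\<in>{..s}. \<lfloor>jet_sample s \<beta> m G 0 i\<rfloor>,
      \<lambda>(j, i)\<in>{..<2 * m} \<times> {..s}. jet_increment s \<beta> m G j i)"

definition jet_codes :: "nat \<Rightarrow> nat \<Rightarrow> ((nat \<Rightarrow> int) \<times> (nat \<times> nat \<Rightarrow> int)) set" where
  "jet_codes s m =
     ({..s} \<rightarrow>\<^sub>E {- int (m ^ Suc s)..int (m ^ Suc s)}) \<times>
     ({..<2 * m} \<times> {..s} \<rightarrow>\<^sub>E {- int (s + 4)..int (s + 4)})"

lemma finite_jet_codes: "finite (jet_codes s m)"
  unfolding jet_codes_def by (intro finite_cartesian_product finite_PiE) auto

lemma card_jet_codes:
  "card (jet_codes s m) = (2 * m ^ Suc s + 1) ^ Suc s * (2 * s + 9) ^ (2 * m * Suc s)"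
proof -
  have card_sym: "card {- int n..int n} = 2 * n + 1" for n by simp
  show ?thesis
    unfolding jet_codes_def
    by (simp only: card_cartesian_product card_PiE[OF finite_atMost]
        card_PiE[OF finite_cartesian_product[OF finite_lessThan finite_atMost]] card_sym prod_constant
        card_lessThan card_atMost) (simp add: algebra_simps)
qed

lemma jet_increment_bound:
  assumes "lip_jet s \<beta> G" "\<beta> > 0" "m > 0" "j < 2 * m" "i \<le> s"
  shows "jet_increment s \<beta> m G j i \<in> {- int (s + 4)..int (s + 4)}"
proof -
  define a where "a = jet_sample s \<beta> m G (Suc j) i"
  define b where "b = taylor_shift s (\<lambda>l. of_int \<lfloor>jet_sample s \<beta> m G j l\<rfloor>) i"
  have "\<bar>a - b\<bar> \<le> real s + 3"
    using jet_sample_step[OF assms] taylor_shift_floor[OF assms(5), of "jet_sample s \<beta> m G j"]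
    unfolding a_def b_def by linarith
  then have "\<lfloor>a\<rfloor> \<le> \<lfloor>b\<rfloor> + int (s + 4)" "\<lfloor>b\<rfloor> \<le> \<lfloor>a\<rfloor> + int (s + 4)"
    by linarith+
  then show ?thesis unfolding jet_increment_def a_def[symmetric] b_def[symmetric] by auto
qed

lemma jet_code_in:
  assumes jet: "lip_jet s \<beta> G" and \<beta>: "0 < \<beta>" "\<beta> \<le> 1" and m: "m > 0"
  shows "jet_code s \<beta> m G \<in> jet_codes s m"
proof -
  have "\<lfloor>jet_sample s \<beta> m G 0 i\<rfloor> \<in> {- int (m ^ Suc s)..int (m ^ Suc s)}" if "i \<le> s" for i
  proof -
    have G1: "\<bar>G i (-1)\<bar> \<le> 1" using jet that unfolding lip_jet_def by auto
    have "real m powr (s + \<beta> - i) \<le> real m powr (Suc s)"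
      using m \<beta> by (intro powr_mono) auto
    also have "\<dots> = real (m ^ Suc s)" using m powr_realpow[of "real m" "Suc s"] by simp
    finally have "\<bar>G i (-1)\<bar> * real m powr (s + \<beta> - i) \<le> 1 * real (m ^ Suc s)"
      using G1 by (intro mult_mono) auto
    then have "\<bar>jet_sample s \<beta> m G 0 i\<bar> \<le> real (m ^ Suc s)"
      by (simp add: jet_sample_def abs_mult)
    then show ?thesis
      using floor_mono[of "- real (m ^ Suc s)" "jet_sample s \<beta> m G 0 i"]
        floor_mono[of "jet_sample s \<beta> m G 0 i" "real (m ^ Suc s)"]
      by (simp add: abs_le_iff floor_minus del: power_Suc of_nat_power)
  qed
  then show ?thesis
    unfolding jet_code_def jet_codes_def using jet_increment_bound[OF jet \<beta>(1) m]
    by (auto simp del: atLeastAtMost_iff power_Suc of_nat_power)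
qed

text \<open>The prediction uses the rounded current samples only, so equal codes make the recursion run
  identically.\<close>

lemma jet_code_eq_floor:
  assumes eq: "jet_code s \<beta> m G = jet_code s \<beta> m H" and "j \<le> 2 * m" "i \<le> s"
  shows "\<lfloor>jet_sample s \<beta> m G j i\<rfloor> = \<lfloor>jet_sample s \<beta> m H j i\<rfloor>"
  using assms(2,3)
proof (induction j arbitrary: i)
  case 0
  then show ?case using arg_cong[OF eq, of "\<lambda>c. fst c i"] by (simp add: jet_code_def)
next
  case (Suc j)
  then have "jet_increment s \<beta> m G j i = jet_increment s \<beta> m H j i"
    using arg_cong[OF eq, of "\<lambda>c. snd c (j, i)"] by (simp add: jet_code_def)
  moreover have "taylor_shift s (\<lambda>l. of_int \<lfloor>jet_sample s \<beta> m G j l\<rfloor>) i =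
      taylor_shift s (\<lambda>l. of_int \<lfloor>jet_sample s \<beta> m H j l\<rfloor>) i"
    unfolding taylor_shift_def using Suc.IH Suc.prems by (intro sum.cong) simp_all
  ultimately show ?case by (simp add: jet_increment_def)
qed

text \<open>Equal rounded samples at the grid point to the left of \<open>y\<close> mean that the two Taylor polynomials
  there differ by at most \<open>s + 1\<close> units at \<open>y\<close>; each of the two remainders adds at most \<open>2\<close>.\<close>

lemma jet_code_close:
  assumes G: "lip_jet s \<beta> G" and H: "lip_jet s \<beta> H" and \<beta>: "\<beta> > 0" and m: "m > 0"
    and eq: "jet_code s \<beta> m G = jet_code s \<beta> m H" and y: "y \<in> {-1..1}"
  shows "\<bar>G 0 y - H 0 y\<bar> \<le> (real s + 5) * (1 / real m) powr (s + \<beta>)"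
proof -
  define j where "j = nat \<lfloor>(y + 1) * real m\<rfloor>"
  define x where "x = -1 + real j / real m"
  define e where "e = (1 / real m) powr (s + \<beta>)"
  have "0 \<le> (y + 1) * real m" using y by simp
  then have j: "real j \<le> (y + 1) * real m" "(y + 1) * real m \<le> real j + 1"
    unfolding j_def by linarith+
  have "(y + 1) * real m \<le> 2 * real m" using y by (intro mult_right_mono) auto
  then have j2: "j \<le> 2 * m" using j by linarith
  have "x \<le> y" using j(1) m by (simp add: x_def field_simps)
  have "y + 1 \<le> (real j + 1) / real m" using j(2) m by (simp add: pos_le_divide_eq)
  then have "y - x \<le> 1 / real m" by (simp add: x_def add_divide_distrib)
  moreover have "1 / real m \<le> 1" using m by simp
  moreover have "-1 \<le> x" by (simp add: x_def)
  ultimately have x: "-1 \<le> x" "x \<le> y" "y - x \<le> 1" "y - x \<le> 1 / real m" using \<open>x \<le> y\<close> by auto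
  have T: "\<bar>F 0 y - (\<Sum>l\<le>s. F l x * (y - x) ^ l / fact l)\<bar> \<le> 2 * e" if "lip_jet s \<beta> F" for F
  proof -
    have "\<bar>F 0 y - (\<Sum>l\<le>s. F (0 + l) x * (y - x) ^ l / fact l)\<bar> \<le> 2 * (y - x) powr (s + \<beta>)"
      using x y by (intro jet_taylor[OF that \<beta>]) auto
    also have "\<dots> \<le> 2 * e"
      unfolding e_def using x \<beta> by (intro mult_left_mono powr_mono2) auto
    finally show ?thesis by simp
  qed
  have "\<bar>\<Sum>l\<le>s. (G l x - H l x) * (y - x) ^ l / fact l\<bar> \<le> (\<Sum>l\<le>s. e)"
  proof (intro order.trans[OF sum_abs] sum_mono)
    fix l assume l: "l \<in> {..s}"
    define w where "w = real m powr (s + \<beta> - l)"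
    have w: "w > 0" using m by (simp add: w_def)
    have "\<lfloor>G l x * w\<rfloor> = \<lfloor>H l x * w\<rfloor>"
      using jet_code_eq_floor[OF eq j2, of l] l unfolding jet_sample_def x_def w_def by simp
    then have "\<bar>G l x * w - H l x * w\<bar> \<le> 1" by linarith
    then have "\<bar>G l x - H l x\<bar> * w \<le> 1"
      using w by (metis abs_mult abs_of_pos left_diff_distrib)
    then have "\<bar>G l x - H l x\<bar> \<le> 1 / w" using w by (simp add: field_simps)
    moreover have "(y - x) ^ l / fact l \<le> (1 / real m) ^ l / 1"
      using x by (intro frac_le power_mono) auto
    ultimately have "\<bar>G l x - H l x\<bar> * ((y - x) ^ l / fact l) \<le> 1 / w * ((1 / real m) ^ l / 1)"
      using x w by (intro mult_mono) auto
    also have "\<dots> = e"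
      using m powr_diff[of "real m" "s + \<beta>" "real l"]
      by (simp add: w_def e_def powr_divide powr_realpow power_divide)
    finally show "\<bar>(G l x - H l x) * (y - x) ^ l / fact l\<bar> \<le> e"
      using x by (simp add: abs_mult)
  qed
  moreover have "(\<Sum>l\<le>s. (G l x - H l x) * (y - x) ^ l / fact l) =
      (\<Sum>l\<le>s. G l x * (y - x) ^ l / fact l) - (\<Sum>l\<le>s. H l x * (y - x) ^ l / fact l)"
    by (simp add: sum_subtractf left_diff_distrib diff_divide_distrib)
  ultimately have "\<bar>(\<Sum>l\<le>s. G l x * (y - x) ^ l / fact l) - (\<Sum>l\<le>s. H l x * (y - x) ^ l / fact l)\<bar>
      \<le> (real s + 1) * e" by (simp add: algebra_simps)
  then have "\<bar>G 0 y - H 0 y\<bar> \<le> (real s + 1) * e + 2 * e + 2 * e"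
    using T[OF G] T[OF H] by linarith
  then show ?thesis by (simp add: e_def algebra_simps)
qed

section \<open>Coding the direction\<close>

text \<open>Rounding all coordinates with step \<open>1 / N\<close> changes the inner products with points of the ball by
  at most \<open>d / N\<close>. For a precision \<open>\<eta>\<close> this takes \<open>N = d / \<eta>\<close>, hence about
  \<open>d * log d + d * log (1 / \<eta>)\<close> bits. A Euclidean net of the ball would avoid the first summand,
  but the upper bound is only claimed for \<open>k\<close> of at least this order.\<close>

definition direction_code :: "nat \<Rightarrow> nat \<Rightarrow> (nat \<Rightarrow> real) \<Rightarrow> nat \<Rightarrow> int" where
  "direction_code d N a = (\<lambda>i\<in>{..<d}. \<lfloor>a i * real N\<rfloor>)"

lemma direction_code_in:
  assumes "a \<in> unit_ball d"
  shows "direction_code d N a \<in> {..<d} \<rightarrow>\<^sub>E {- int N..int N}"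
proof -
  have "\<lfloor>a i * real N\<rfloor> \<in> {- int N..int N}" if "i < d" for i
  proof -
    have "\<bar>a i * real N\<bar> \<le> real N"
      using unit_ball_coordinate[OF assms that] by (simp add: abs_mult mult_left_le_one_le)
    then show ?thesis
      using floor_mono[of "- real N" "a i * real N"] floor_mono[of "a i * real N" "real N"]
      by (simp add: abs_le_iff floor_minus)
  qed
  then show ?thesis unfolding direction_code_def by (auto simp del: atLeastAtMost_iff)
qed

lemma direction_code_close:
  assumes eq: "direction_code d N a = direction_code d N b" and x: "x \<in> unit_ball d" and N: "N > 0"
  shows "\<bar>(\<Sum>i<d. a i * x i) - (\<Sum>i<d. b i * x i)\<bar> \<le> real d / real N"
proof -
  have "\<bar>(a i - b i) * x i\<bar> \<le> 1 / real N" if "i < d" for i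
  proof -
    have "\<lfloor>a i * real N\<rfloor> = \<lfloor>b i * real N\<rfloor>"
      using fun_cong[OF eq, of i] that by (simp add: direction_code_def)
    then have "\<bar>a i * real N - b i * real N\<bar> \<le> 1" by linarith
    then have "\<bar>a i - b i\<bar> * real N \<le> 1"
      by (metis abs_mult abs_of_nat left_diff_distrib)
    then have "\<bar>a i - b i\<bar> \<le> 1 / real N" using N by (simp add: field_simps)
    then have "\<bar>a i - b i\<bar> * \<bar>x i\<bar> \<le> 1 / real N * 1"
      using unit_ball_coordinate[OF x that] by (intro mult_mono) auto
    then show ?thesis by (simp add: abs_mult)
  qed
  then have "(\<Sum>i<d. \<bar>(a i - b i) * x i\<bar>) \<le> (\<Sum>i<d. 1 / real N)" by (intro sum_mono) auto
  moreover have "(\<Sum>i<d. a i * x i) - (\<Sum>i<d. b i * x i) = (\<Sum>i<d. (a i - b i) * x i)"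
    by (simp add: sum_subtractf left_diff_distrib)
  ultimately show ?thesis using sum_abs[of "\<lambda>i. (a i - b i) * x i" "{..<d}"] by (simp del: sum_abs)
qed

section \<open>Ridge functions\<close>

definition ridge :: "nat \<Rightarrow> (real \<Rightarrow> real) \<Rightarrow> (nat \<Rightarrow> real) \<Rightarrow> (nat \<Rightarrow> real) \<Rightarrow> real" where
  "ridge d g a = (\<lambda>x\<in>unit_ball d. g (\<Sum>i<d. a i * x i))"

lemma ridge_measurable:
  assumes g: "continuous_on {-1..1} g" and a: "a \<in> unit_ball d"
  shows "ridge d g a \<in> borel_measurable (ball_measure d)"
proof -
  \<comment> \<open>Clamping the argument extends \<open>g\<close> to a continuous function on the whole line.\<close>
  define h where "h t = g (max (-1) (min 1 t))" for t
  have "continuous_on UNIV h"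
    unfolding h_def by (rule continuous_on_compose2[OF g]) (auto intro!: continuous_intros)
  then have [measurable]: "h \<in> borel_measurable borel" by (rule borel_measurable_continuous_onI)
  have "(\<lambda>x. h (\<Sum>i<d. a i * x i)) \<in> borel_measurable (\<Pi>\<^sub>M i\<in>{..<d}. lborel)"
    by measurable
  then have "(\<lambda>x. h (\<Sum>i<d. a i * x i)) \<in> borel_measurable (ball_measure d)"
    unfolding ball_measure_def by (intro measurable_restrict_space1 measurable_completion)
  moreover have "h (\<Sum>i<d. a i * x i) = ridge d g a x" if "x \<in> space (ball_measure d)" for x
    using inner_unit_ball[OF a, of x] that by (simp add: ridge_def h_def)
  ultimately show ?thesis by (rule measurable_cong[THEN iffD1, rotated])
qed

lemma ridge_class_eq_jets:
  assumes "\<alpha> > 0"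
  shows "ridge_class \<alpha> d = (\<lambda>(G, a). ridge d (G 0) a) `
           ({G. lip_jet (lip_order \<alpha>) (\<alpha> - lip_order \<alpha>) G} \<times> unit_ball d)"
proof (intro equalityI subsetI)
  fix f assume "f \<in> ridge_class \<alpha> d"
  then obtain g a where f: "f = ridge d g a" "a \<in> unit_ball d"
      and g: "g \<in> Lip_space \<alpha> {-1..1}" "Lip_norm \<alpha> {-1..1} g \<le> 1"
    unfolding ridge_class_def ridge_def by blast
  show "f \<in> (\<lambda>(G, a). ridge d (G 0) a) `
      ({G. lip_jet (lip_order \<alpha>) (\<alpha> - lip_order \<alpha>) G} \<times> unit_ball d)"
    using f Lip_unit_ball_jet[OF g]
    by (intro image_eqI[where x="(\<lambda>i. deriv_on {-1..1} i g, a)"]) auto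
next
  fix f assume "f \<in> (\<lambda>(G, a). ridge d (G 0) a) `
      ({G. lip_jet (lip_order \<alpha>) (\<alpha> - lip_order \<alpha>) G} \<times> unit_ball d)"
  then obtain G a where "f = ridge d (G 0) a" "a \<in> unit_ball d"
      and "lip_jet (lip_order \<alpha>) (\<alpha> - lip_order \<alpha>) G" by auto
  then show "f \<in> ridge_class \<alpha> d"
    using jet_Lip_unit_ball[OF _ assms, of G] unfolding ridge_class_def ridge_def by blast
qed

lemma ridge_bound:
  assumes "lip_jet s \<beta> G" "a \<in> unit_ball d" "x \<in> unit_ball d"
  shows "\<bar>ridge d (G 0) a x\<bar> \<le> 1"
  using assms inner_unit_ball[OF assms(2,3)] unfolding lip_jet_def ridge_def by simp

lemma ridge_Linf:
  assumes "lip_jet s \<beta> G" "\<beta> > 0" "a \<in> unit_ball d"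
  shows "ridge d (G 0) a \<in> Linf (ball_measure d)"
  using assms ridge_bound[OF assms(1,3)]
  by (intro LinfI[where C=1] ridge_measurable jet_continuous) auto

section \<open>The upper bounds\<close>

lemma entropy_ridge_class_le_2:
  assumes "\<alpha> > 0"
  shows "entropy_number k (ridge_class \<alpha> d) (Linf (ball_measure d)) (Linf_norm (ball_measure d))
           \<le> ereal 2"
proof (rule entropy_number_le_code[where code="\<lambda>_. ()" and S=UNIV and F="\<lambda>(G, a). ridge d (G 0) a"])
  note \<beta> = lip_order[OF assms]
  show "ridge_class \<alpha> d \<subseteq> (\<lambda>(G, a). ridge d (G 0) a) `
      ({G. lip_jet (lip_order \<alpha>) (\<alpha> - lip_order \<alpha>) G} \<times> unit_ball d)"
    using ridge_class_eq_jets[OF assms] by simp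
  show "(case p of (G, a) \<Rightarrow> ridge d (G 0) a) \<in> Linf (ball_measure d)"
    if "p \<in> {G. lip_jet (lip_order \<alpha>) (\<alpha> - lip_order \<alpha>) G} \<times> unit_ball d" for p
    using that \<beta> by (auto intro: ridge_Linf)
  show "\<bar>(case p of (G, a) \<Rightarrow> ridge d (G 0) a) x - (case q of (G, a) \<Rightarrow> ridge d (G 0) a) x\<bar> \<le> 2"
    if "p \<in> {G. lip_jet (lip_order \<alpha>) (\<alpha> - lip_order \<alpha>) G} \<times> unit_ball d"
      "q \<in> {G. lip_jet (lip_order \<alpha>) (\<alpha> - lip_order \<alpha>) G} \<times> unit_ball d"
      "x \<in> space (ball_measure d)" for p q x
    using that ridge_bound[of _ _ "fst p" "snd p" d x] ridge_bound[of _ _ "fst q" "snd q" d x]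
    by (fastforce simp: split_beta)
qed auto

text \<open>The two codes are combined; the accuracy of the direction is matched to the accuracy
  \<open>m powr (- \<alpha>)\<close> of the profile.\<close>

lemma entropy_ridge_class_le:
  assumes "\<alpha> > 0" and s: "s = lip_order \<alpha>" and d: "d \<ge> 1" and m: "m > 0"
    and card: "(2 * m ^ Suc s + 1) ^ Suc s * (2 * s + 9) ^ (2 * m * Suc s) *
                 (2 * (d * m ^ Suc s) + 1) ^ d \<le> 2 ^ (k - 1)"
  shows "entropy_number k (ridge_class \<alpha> d) (Linf (ball_measure d)) (Linf_norm (ball_measure d))
           \<le> ereal ((real s + 7) * (1 / real m) powr \<alpha>)"
proof -
  define \<beta> where "\<beta> = \<alpha> - s"
  have \<beta>: "0 < \<beta>" "\<beta> \<le> 1" "s + \<beta> = \<alpha>"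
    using lip_order[OF assms(1)] by (auto simp: \<beta>_def s)
  define N where "N = d * m ^ Suc s"
  have N: "N > 0" using d m by (simp add: N_def)
  define S where "S = jet_codes s m \<times> ({..<d} \<rightarrow>\<^sub>E {- int N..int N})"
  define code where "code = (\<lambda>(G, a). (jet_code s \<beta> m G, direction_code d N a))"
  define I where "I = {G. lip_jet s \<beta> G} \<times> unit_ball d"
  have card_sym: "card {- int N..int N} = 2 * N + 1" by simp
  have "card S = card (jet_codes s m) * (2 * N + 1) ^ d"
    unfolding S_def by (simp only: card_cartesian_product card_PiE[OF finite_lessThan] card_sym
        prod_constant card_lessThan)
  then have S: "finite S" "card S \<le> 2 ^ (k - 1)"
    using card unfolding S_def card_jet_codes N_def
    by (auto intro!: finite_cartesian_product finite_jet_codes finite_PiE simp del: power_Suc)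
  have "\<bar>ridge d (G 0) a x - ridge d (H 0) b x\<bar> \<le> (real s + 7) * (1 / real m) powr \<alpha>"
    if G: "lip_jet s \<beta> G" and H: "lip_jet s \<beta> H" and a: "a \<in> unit_ball d" and b: "b \<in> unit_ball d"
      and x: "x \<in> unit_ball d" and eq: "jet_code s \<beta> m G = jet_code s \<beta> m H"
      "direction_code d N a = direction_code d N b" for G H a b x
  proof -
    define u v where "u = (\<Sum>i<d. a i * x i)" and "v = (\<Sum>i<d. b i * x i)"
    have uv: "u \<in> {-1..1}" "v \<in> {-1..1}"
      using inner_unit_ball a b x unfolding u_def v_def by auto
    have "\<bar>u - v\<bar> \<le> real d / real N"
      unfolding u_def v_def using direction_code_close[OF eq(2) x N] .
    also have "\<dots> = (1 / real m) ^ Suc s"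
      using d by (simp add: N_def power_divide)
    finally have "\<bar>G 0 u - G 0 v\<bar> \<le> 2 * (1 / real m) powr (s + \<beta>)"
      using m by (intro jet_modulus[OF G \<beta>(1,2) uv]) auto
    moreover have "\<bar>G 0 v - H 0 v\<bar> \<le> (real s + 5) * (1 / real m) powr (s + \<beta>)"
      by (rule jet_code_close[OF G H \<beta>(1) m eq(1) uv(2)])
    ultimately have "\<bar>G 0 u - H 0 v\<bar> \<le> (real s + 7) * (1 / real m) powr \<alpha>"
      unfolding \<beta>(3) by (simp add: algebra_simps)
    then show ?thesis using x by (simp add: ridge_def u_def v_def)
  qed
  then have close: "\<bar>(case p of (G, a) \<Rightarrow> ridge d (G 0) a) x - (case q of (G, a) \<Rightarrow> ridge d (G 0) a) x\<bar>
      \<le> (real s + 7) * (1 / real m) powr \<alpha>"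
    if "p \<in> I" "q \<in> I" "code p = code q" "x \<in> space (ball_measure d)" for p q x
    using that unfolding I_def code_def by (auto simp: split_beta)
  have "code ` I \<subseteq> S"
    unfolding code_def I_def S_def using jet_code_in[OF _ \<beta>(1,2) m] direction_code_in by fastforce
  then show ?thesis
    using S close ridge_class_eq_jets[OF assms(1)] \<beta> m
    by (intro entropy_number_le_code[where code=code and S=S and I=I and F="\<lambda>(G, a). ridge d (G 0) a"])
      (auto simp: I_def \<beta>_def s intro: ridge_Linf)
qed

lemma log2_le_sqrt:
  assumes "y > 0"
  shows "log 2 y \<le> 4 * sqrt y"
proof -
  have "log 2 y = 2 * log 2 (sqrt y)" using assms by (simp add: log_def ln_sqrt)
  also have "log 2 (sqrt y) \<le> 2 * sqrt y"
  proof -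
    have "ln (sqrt y) \<le> sqrt y" using ln_le_minus_one[of "sqrt y"] assms by simp
    also have "\<dots> \<le> 2 * sqrt y * ln 2"
      using mult_left_mono[OF ln2_ge_two_thirds, of "sqrt y"] assms by simp
    finally show ?thesis by (simp add: log_def divide_le_eq)
  qed
  finally show ?thesis by simp
qed

text \<open>This is what determines the threshold \<open>d * log d\<close>. Writing \<open>k = d * y\<close>, the term
  \<open>d * log k\<close> splits into \<open>d * log d\<close> and \<open>d * log y\<close>, and the latter is small compared with
  \<open>k\<close> because \<open>log y\<close> is small compared with \<open>y\<close>.\<close>

lemma dimension_cost:
  fixes d k p r :: real
  assumes d: "d \<ge> 1" and p: "p \<ge> 1" and r: "r \<ge> 20 * (p + 1)"
    and k: "k \<ge> r\<^sup>2 * d" "k \<ge> r\<^sup>2 * d * log 2 d"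
  shows "d * (2 + log 2 d + p * log 2 k) \<le> k / 4"
proof -
  define y where "y = k / d"
  have r1: "r \<ge> 1" using r p by simp
  have y: "r\<^sup>2 \<le> y" "k = d * y" using k(1) d by (auto simp: y_def field_simps)
  have y0: "y > 0" using y(1) r1 by (meson less_le_trans zero_less_power zero_less_one)
  have k0: "k > 0" using y y0 d by simp
  have rr: "r \<le> r\<^sup>2" using r1 by (simp add: power2_eq_square)
  have logd: "log 2 d \<ge> 0" using d by simp
  have 1: "d * r \<le> k" using mult_left_mono[OF rr, of d] k(1) d mult.commute[of d "r\<^sup>2"] by linarith
  have 2: "d * log 2 d * r \<le> k"
  proof -
    have "d * log 2 d * r \<le> d * log 2 d * r\<^sup>2" using rr d logd by (intro mult_left_mono) auto
    also have "\<dots> = r\<^sup>2 * d * log 2 d" by (simp add: ac_simps)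
    finally show ?thesis using k(2) by linarith
  qed
  have 3: "d * log 2 y * r \<le> 4 * k"
  proof -
    have "r \<le> sqrt y" using y(1) r1 by (simp add: real_le_rsqrt)
    then have "sqrt y * r \<le> sqrt y * sqrt y" using y0 by (intro mult_left_mono) auto
    then have "4 * sqrt y * r \<le> 4 * y" using y0 by simp
    moreover have "log 2 y * r \<le> 4 * sqrt y * r"
      using log2_le_sqrt[OF y0] r1 by (intro mult_right_mono) auto
    ultimately have "log 2 y * r \<le> 4 * y" by simp
    then show ?thesis using mult_left_mono[of "log 2 y * r" "4 * y" d] d y(2) by (simp add: algebra_simps)
  qed
  have "log 2 k = log 2 d + log 2 y" using y(2) d y0 by (simp add: log_mult)
  then have "d * (2 + log 2 d + p * log 2 k) * r =
      2 * (d * r) + d * log 2 d * r + p * (d * log 2 d * r) + p * (d * log 2 y * r)"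
    by (simp add: algebra_simps)
  also have "\<dots> \<le> 2 * k + k + p * k + p * (4 * k)"
    using 1 2 3 p by (intro add_mono mult_left_mono) auto
  also have "\<dots> = (3 + 5 * p) * k" by (simp add: algebra_simps)
  also have "\<dots> \<le> (r / 4) * k"
    using k0 r p by (intro mult_right_mono) auto
  finally have "d * (2 + log 2 d + p * log 2 k) * r \<le> k / 4 * r" by (simp add: algebra_simps)
  then show ?thesis by (rule mult_right_le_imp_le) (use r1 in simp)
qed

text \<open>The three factors count the initial samples, the increments and the directions. Because of
  \<open>3 * m \<le> 4 ^ m\<close> even the initial samples take only a multiple of \<open>m\<close> bits.\<close>

lemma code_count_le:
  fixes d k s :: nat
  defines "p \<equiv> Suc s"
  defines "L \<equiv> 2 * p\<^sup>2 + 2 * p * (2 * p + 7)"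
  assumes d: "d \<ge> 1" and m: "m > 0" and mk: "real m * real L \<le> real k / 4" and "k \<ge> 2"
    and cost: "real d * (2 + log 2 (real d) + real p * log 2 (real k)) \<le> real k / 4"
  shows "(2 * m ^ p + 1) ^ p * (2 * s + 9) ^ (2 * m * p) * (2 * (d * m ^ p) + 1) ^ d \<le> 2 ^ (k - 1)"
proof -
  have p: "p \<ge> 1" by (simp add: p_def)
  have "3 * m \<le> 4 ^ m" using m
  proof (induction m rule: nat_induct_non_zero)
    case (Suc n)
    then show ?case using one_le_power[of "4::nat" n] by simp
  qed simp
  then have "(3 * m) ^ p \<le> (4 ^ m) ^ p" by (rule power_mono) simp
  moreover have "2 * m ^ p + 1 \<le> (3 * m) ^ p"
  proof -
    have "2 * m ^ p + 1 \<le> 3 * m ^ p" using m by simp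
    also have "\<dots> \<le> 3 ^ p * m ^ p" using p self_le_power[of "3::nat" p] by (intro mult_right_mono) auto
    finally show ?thesis by (simp add: power_mult_distrib)
  qed
  ultimately have "2 * m ^ p + 1 \<le> (4 ^ m) ^ p" by simp
  also have "\<dots> = (2 ^ (2 * m * p) :: nat)" by (simp add: power_mult)
  finally have A: "(2 * m ^ p + 1) ^ p \<le> (2 ^ (2 * m * p)) ^ p" by (rule power_mono) simp
  have "2 * s + 9 \<le> 2 ^ (2 * p + 7)" using less_imp_le[OF less_exp[of "2 * p + 7"]] unfolding p_def by (simp add: add.commute)
  then have B: "(2 * s + 9) ^ (2 * m * p) \<le> (2 ^ (2 * p + 7)) ^ (2 * m * p)" by (rule power_mono) simp
  have "(2 * m ^ p + 1) ^ p * (2 * s + 9) ^ (2 * m * p) \<le> (2 ^ (2 * m * p)) ^ p * (2 ^ (2 * p + 7)) ^ (2 * m * p)"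
    using A B by (rule mult_mono) auto
  also have "\<dots> = 2 ^ (m * L)"
    by (simp add: L_def power2_eq_square algebra_simps flip: power_mult power_add)
  finally have AB: "(2 * m ^ p + 1) ^ p * (2 * s + 9) ^ (2 * m * p) \<le> 2 ^ (m * L)" .
  have L: "L \<ge> 1" by (simp add: L_def p_def)
  have "real m * 1 \<le> real m * real L" using L by (intro mult_left_mono) auto
  then have "m \<le> k" using mk by linarith
  have "real (2 * (d * m ^ p) + 1) \<le> 4 * (real d * real m ^ p)"
  proof -
    have "1 \<le> d * m ^ p" using d m by simp
    then have "2 * (d * m ^ p) + 1 \<le> 4 * (d * m ^ p)" by linarith
    then show ?thesis by (metis of_nat_le_iff of_nat_mult of_nat_numeral of_nat_power)
  qed
  also have "\<dots> \<le> 4 * (real d * real k ^ p)"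
    using \<open>m \<le> k\<close> by (intro mult_left_mono power_mono) auto
  also have "\<dots> = 2 powr (2 + log 2 (real d) + real p * log 2 (real k))"
    using d \<open>k \<ge> 2\<close> by (simp add: powr_add powr_realpow[symmetric] powr_powr[symmetric] mult.commute[of "real p"])
  finally have "real (2 * (d * m ^ p) + 1) ^ d \<le> (2 powr (2 + log 2 (real d) + real p * log 2 (real k))) ^ d"
    by (rule power_mono) simp
  also have "\<dots> = 2 powr (real d * (2 + log 2 (real d) + real p * log 2 (real k)))"
    by (simp add: powr_realpow[symmetric] powr_powr mult.commute)
  also have "\<dots> \<le> 2 powr (real k / 4)" using cost by simp
  finally have D: "real (2 * (d * m ^ p) + 1) ^ d \<le> 2 powr (real k / 4)" .
  have "real ((2 * m ^ p + 1) ^ p * (2 * s + 9) ^ (2 * m * p)) \<le> real (2 ^ (m * L))"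
    using AB by (rule of_nat_mono)
  also have "\<dots> = 2 powr (real m * real L)" by (simp add: powr_realpow[symmetric])
  also have "\<dots> \<le> 2 powr (real k / 4)" using mk by simp
  finally have "real ((2 * m ^ p + 1) ^ p * (2 * s + 9) ^ (2 * m * p)) * real (2 * (d * m ^ p) + 1) ^ d
      \<le> 2 powr (real k / 4) * 2 powr (real k / 4)"
    using D by (rule mult_mono) auto
  also have "\<dots> = 2 powr (real k / 2)" by (simp add: powr_add[symmetric])
  also have "\<dots> \<le> 2 powr (real (k - 1))" using \<open>k \<ge> 2\<close> by (intro powr_mono) (auto simp: of_nat_diff)
  also have "\<dots> = real (2 ^ (k - 1))" by (subst powr_realpow) auto
  finally show ?thesis by (metis of_nat_le_iff of_nat_mult of_nat_power)
qed

text \<open>A quarter of the \<open>k\<close> bits is spent on the profile and a quarter on the direction. The code of the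
  profile takes at most \<open>m * L\<close> bits, which leads to \<open>m = k / (4 * L)\<close>, and the two summands of the
  constant \<open>c\<close> ensure that this is at least \<open>1\<close> and that the direction fits into its share.\<close>

lemma entropy_ridge_class_upper:
  assumes "\<alpha> > 0"
  shows "\<exists>c B. c > 0 \<and> B \<ge> 2 \<and> (\<forall>d k :: nat. d \<ge> 1 \<longrightarrow> k \<ge> 1 \<longrightarrow> real k \<ge> c * real d * log 2 (real d) \<longrightarrow>
           entropy_number k (ridge_class \<alpha> d) (Linf (ball_measure d)) (Linf_norm (ball_measure d))
             \<le> ereal (B * real k powr (- \<alpha>)))"
proof -
  define s where "s = lip_order \<alpha>"
  define p where "p = Suc s"
  define L where "L = 2 * p\<^sup>2 + 2 * p * (2 * p + 7)"
  define r where "r = 20 * (real p + 1)"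
  define c where "c = 4 * real L + r\<^sup>2"
  define B where "B = 2 * c powr \<alpha> + (real s + 7) * (8 * real L) powr \<alpha>"
  have L: "L \<ge> 1" by (simp add: L_def p_def)
  have r2: "r\<^sup>2 \<ge> 1" by (simp add: r_def)
  have c: "c \<ge> 4 * real L" "c \<ge> r\<^sup>2" "c \<ge> 2" using L r2 by (auto simp: c_def)
  have c1: "c powr \<alpha> \<ge> 1" using c assms by (intro ge_one_powr_ge_zero) auto
  have B: "B \<ge> 2" "B \<ge> 2 * c powr \<alpha>" "B \<ge> (real s + 7) * (8 * real L) powr \<alpha>"
  proof -
    have "(real s + 7) * (8 * real L) powr \<alpha> \<ge> 0" by simp
    then show "B \<ge> 2" "B \<ge> 2 * c powr \<alpha>" "B \<ge> (real s + 7) * (8 * real L) powr \<alpha>"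
      unfolding B_def using c1 by linarith+
  qed
  have "entropy_number k (ridge_class \<alpha> d) (Linf (ball_measure d)) (Linf_norm (ball_measure d))
          \<le> ereal (B * real k powr (- \<alpha>))"
    if d: "d \<ge> 1" and k: "k \<ge> 1" and kd: "real k \<ge> c * real d * log 2 (real d)" for d k
  proof (cases "real k \<ge> c * real d")
    case True
    define m where "m = nat \<lfloor>real k / (4 * real L)\<rfloor>"
    have "c * 1 \<le> c * real d" using c d by (intro mult_left_mono) auto
    then have kc: "real k \<ge> c" using True by simp
    define q where "q = real k / (4 * real L)"
    have q1: "q \<ge> 1" using kc c(1) L by (simp add: q_def)
    have mq: "real m \<le> q" "q \<le> 2 * real m" "m > 0"
    proof -
      have "\<lfloor>q\<rfloor> \<ge> 1" using q1 by simp
      then have "real m = of_int \<lfloor>q\<rfloor>" by (simp add: m_def q_def)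
      then show "real m \<le> q" "q \<le> 2 * real m" "m > 0" using \<open>\<lfloor>q\<rfloor> \<ge> 1\<close> by linarith+
    qed
    have mk: "real m * real L \<le> real k / 4"
      using mult_right_mono[OF mq(1), of "real L"] L by (simp add: q_def)
    have "r\<^sup>2 * real d \<le> c * real d" using c by (intro mult_right_mono) auto
    then have kr: "real k \<ge> r\<^sup>2 * real d" using True by simp
    have "r\<^sup>2 * (real d * log 2 (real d)) \<le> c * (real d * log 2 (real d))"
      using c d by (intro mult_right_mono) auto
    then have krl: "real k \<ge> r\<^sup>2 * real d * log 2 (real d)" using kd by (simp add: mult.assoc)
    have cost: "real d * (2 + log 2 (real d) + real p * log 2 (real k)) \<le> real k / 4"
      by (rule dimension_cost[OF _ _ _ kr krl]) (use d in \<open>auto simp: p_def r_def\<close>)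
    have "k \<ge> 2" using kc c(3) by linarith
    have "entropy_number k (ridge_class \<alpha> d) (Linf (ball_measure d)) (Linf_norm (ball_measure d))
        \<le> ereal ((real s + 7) * (1 / real m) powr \<alpha>)"
      using code_count_le[of d m s k] d mq(3) mk cost \<open>k \<ge> 2\<close>
      by (intro entropy_ridge_class_le[OF assms s_def d mq(3)]) (simp only: p_def L_def)
    also have "(real s + 7) * (1 / real m) powr \<alpha> \<le> (real s + 7) * ((8 * real L) powr \<alpha> * real k powr (- \<alpha>))"
    proof (rule mult_left_mono)
      have "1 / real m \<le> 8 * real L / real k"
        using mq L k by (simp add: q_def field_simps)
      then have "(1 / real m) powr \<alpha> \<le> (8 * real L / real k) powr \<alpha>"
        using assms by (intro powr_mono2) auto
      also have "\<dots> = (8 * real L) powr \<alpha> * real k powr (- \<alpha>)"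
        by (simp add: powr_divide powr_minus field_simps)
      finally show "(1 / real m) powr \<alpha> \<le> (8 * real L) powr \<alpha> * real k powr (- \<alpha>)" .
    qed simp
    also have "\<dots> \<le> B * real k powr (- \<alpha>)"
      using mult_right_mono[OF B(3), of "real k powr (- \<alpha>)"] by (simp add: mult.assoc)
    finally show ?thesis by simp
  next
    case False
    \<comment> \<open>This happens for \<open>d = 1\<close> only, since \<open>log 2 d \<ge> 1\<close> otherwise; then \<open>k\<close> is bounded.\<close>
    have "d = 1"
    proof (rule ccontr)
      assume "d \<noteq> 1"
      then have "log 2 (real d) \<ge> 1" using d by simp
      then have "c * real d * 1 \<le> c * real d * log 2 (real d)" using c by (intro mult_left_mono) auto
      with kd False show False by simp
    qed
    then have kc: "real k \<le> c" using False by simp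
    have "1 = real k powr \<alpha> * real k powr (- \<alpha>)" using k by (simp add: powr_add[symmetric])
    also have "\<dots> \<le> c powr \<alpha> * real k powr (- \<alpha>)"
      using kc assms by (intro mult_right_mono powr_mono2) auto
    finally have "2 \<le> (2 * c powr \<alpha>) * real k powr (- \<alpha>)" by simp
    also have "\<dots> \<le> B * real k powr (- \<alpha>)" using B(2) by (rule mult_right_mono) simp
    finally have "ereal 2 \<le> ereal (B * real k powr (- \<alpha>))" by simp
    then show ?thesis using entropy_ridge_class_le_2[OF assms] order_trans by blast
  qed
  then show ?thesis using c(3) B(1) by (intro exI[of _ c] exI[of _ B]) auto
qed

section \<open>From almost everywhere to everywhere\<close>

text \<open>Ridge functions with continuous profiles are continuous, so for their differences the essential
  supremum over the ball bounds every single value.\<close>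

lemma ridge_AE_close:
  assumes AE: "AE x in ball_measure d. \<bar>ridge d g a x - ridge d h b x\<bar> \<le> e"
    and g: "continuous_on {-1..1} g" "continuous_on {-1..1} h"
    and a: "a \<in> unit_ball d" "b \<in> unit_ball d" and x: "x \<in> unit_ball d"
  shows "\<bar>ridge d g a x - ridge d h b x\<bar> \<le> e"
proof -
  have "\<exists>y\<in>unit_ball d. (\<forall>i<d. \<bar>y i - x i\<bar> < 1 / real (Suc n)) \<and> \<bar>ridge d g a y - ridge d h b y\<bar> \<le> e" for n
    by (rule AE_ball_measure_dense[OF AE x]) simp
  then obtain y where y: "\<And>n. y n \<in> unit_ball d" "\<And>n i. i < d \<Longrightarrow> \<bar>y n i - x i\<bar> < 1 / real (Suc n)"
      "\<And>n. \<bar>ridge d g a (y n) - ridge d h b (y n)\<bar> \<le> e"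
    by metis
  have y_lim: "(\<lambda>n. y n i) \<longlonglongrightarrow> x i" if "i < d" for i
  proof -
    have "(\<lambda>n. y n i - x i) \<longlonglongrightarrow> 0"
      using y(2)[OF that] by (intro Lim_null_comparison[OF _ LIMSEQ_Suc[OF lim_1_over_n]])
        (auto intro!: always_eventually less_imp_le)
    then show ?thesis by (simp add: LIM_zero_iff)
  qed
  have lim: "(\<lambda>n. f (\<Sum>i<d. c i * y n i)) \<longlonglongrightarrow> f (\<Sum>i<d. c i * x i)"
    if "continuous_on {-1..1} f" "c \<in> unit_ball d" for f :: "real \<Rightarrow> real" and c
    by (rule continuous_on_tendsto_compose[OF that(1)])
      (auto intro!: tendsto_intros y_lim always_eventually simp: inner_unit_ball[OF that(2) x, simplified]
        inner_unit_ball[OF that(2) y(1), simplified])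
  have "(\<lambda>n. \<bar>ridge d g a (y n) - ridge d h b (y n)\<bar>) \<longlonglongrightarrow> \<bar>ridge d g a x - ridge d h b x\<bar>"
    using x y(1) lim[OF g(1) a(1)] lim[OF g(2) a(2)] unfolding ridge_def
    by (simp, intro tendsto_rabs tendsto_diff)
  then show ?thesis by (rule LIMSEQ_le_const2) (use y(3) in auto)
qed

section \<open>The lower bound by varying the direction\<close>

lemma sum_half_powers_le:
  assumes "\<bar>c\<bar> \<le> int R"
  shows "(\<Sum>v\<in>{- int R..int R}. (1 / 2 :: real) ^ nat \<bar>v - c\<bar>) \<le> 3"
proof -
  have eq: "(\<Sum>v\<in>{- int M..int M}. (1 / 2 :: real) ^ nat \<bar>v\<bar>) = 3 - 2 * (1 / 2) ^ M" for M
  proof (induction M)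
    case (Suc M)
    have "{- int (Suc M)..int (Suc M)} = insert (- int (Suc M)) (insert (int (Suc M)) {- int M..int M})"
      by auto
    then show ?case using Suc by (simp add: nat_add_distrib)
  qed simp
  have "(\<Sum>v\<in>{- int R..int R}. (1 / 2 :: real) ^ nat \<bar>v - c\<bar>) =
      (\<Sum>v\<in>(\<lambda>v. v - c) ` {- int R..int R}. (1 / 2) ^ nat \<bar>v\<bar>)"
    by (subst sum.reindex) (auto simp: inj_on_def)
  also have "\<dots> \<le> (\<Sum>v\<in>{- int (2 * R)..int (2 * R)}. (1 / 2) ^ nat \<bar>v\<bar>)"
    using assms by (intro sum_mono2) auto
  also have "\<dots> \<le> 3" unfolding eq by simp
  finally show ?thesis .
qed

text \<open>A Euclidean ball of radius \<open>sqrt d\<close> contains only exponentially many points of the integer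
  lattice. For each of them the weight \<open>\<Prod>i<d. 2 powr (- \<bar>w i - z i\<bar>)\<close> is at least
  \<open>2 powr (- d)\<close>, because \<open>\<bar>n\<bar> \<le> n\<^sup>2\<close> for integers, while the total weight of the lattice
  is a product of \<open>d\<close> convergent sums.\<close>

lemma lattice_points_in_ball:
  fixes z :: "nat \<Rightarrow> int"
  assumes z: "z \<in> {..<d} \<rightarrow>\<^sub>E {- int R..int R}"
  shows "card {w \<in> {..<d} \<rightarrow>\<^sub>E {- int R..int R}. (\<Sum>i<d. (z i - w i)\<^sup>2) \<le> int d} \<le> 6 ^ d"
proof -
  define P where "P = ({..<d} \<rightarrow>\<^sub>E {- int R..int R})"
  define N where "N = {w \<in> P. (\<Sum>i<d. (z i - w i)\<^sup>2) \<le> int d}"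
  have P: "finite P" unfolding P_def by (intro finite_PiE) auto
  have weight: "(1 / 2) ^ d \<le> (\<Prod>i<d. (1 / 2 :: real) ^ nat \<bar>w i - z i\<bar>)" if "w \<in> N" for w
  proof -
    have "(\<Sum>i<d. \<bar>w i - z i\<bar>) \<le> (\<Sum>i<d. (z i - w i)\<^sup>2)"
    proof (rule sum_mono)
      fix i
      have "\<bar>v\<bar> \<le> v\<^sup>2" for v :: int
      proof (cases "v = 0")
        case False
        then have "\<bar>v\<bar> * 1 \<le> \<bar>v\<bar> * \<bar>v\<bar>" by (intro mult_left_mono) auto
        then show ?thesis by (simp add: power2_eq_square)
      qed simp
      from this[of "z i - w i"] show "\<bar>w i - z i\<bar> \<le> (z i - w i)\<^sup>2"
        by (simp only: abs_minus_commute)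
    qed
    also have "\<dots> \<le> int d" using that by (simp add: N_def)
    finally have "int (\<Sum>i<d. nat \<bar>w i - z i\<bar>) \<le> int d" by simp
    then have "(\<Sum>i<d. nat \<bar>w i - z i\<bar>) \<le> d" by linarith
    then have "(1 / 2 :: real) ^ d \<le> (1 / 2) ^ (\<Sum>i<d. nat \<bar>w i - z i\<bar>)"
      by (intro power_decreasing) auto
    then show ?thesis by (simp add: power_sum)
  qed
  have "real (card N) * (1 / 2) ^ d = (\<Sum>w\<in>N. (1 / 2) ^ d)" by simp
  also have "\<dots> \<le> (\<Sum>w\<in>N. \<Prod>i<d. (1 / 2) ^ nat \<bar>w i - z i\<bar>)"
    using weight by (rule sum_mono)
  also have "\<dots> \<le> (\<Sum>w\<in>P. \<Prod>i<d. (1 / 2) ^ nat \<bar>w i - z i\<bar>)"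
    using P by (intro sum_mono2) (auto simp: N_def intro!: prod_nonneg)
  also have "\<dots> = (\<Prod>i<d. \<Sum>v\<in>{- int R..int R}. (1 / 2) ^ nat \<bar>v - z i\<bar>)"
    unfolding P_def by (subst prod_sum_PiE) auto
  also have "\<dots> \<le> (\<Prod>i<d. 3)"
  proof (rule prod_mono)
    fix i assume "i \<in> {..<d}"
    then have "\<bar>z i\<bar> \<le> int R" using PiE_mem[OF z, of i] by auto
    then show "0 \<le> (\<Sum>v\<in>{- int R..int R}. (1 / 2 :: real) ^ nat \<bar>v - z i\<bar>) \<and>
        (\<Sum>v\<in>{- int R..int R}. (1 / 2 :: real) ^ nat \<bar>v - z i\<bar>) \<le> 3"
      using sum_half_powers_le by (auto intro: sum_nonneg)
  qed
  finally have "real (card N) * (1 / 2) ^ d \<le> 3 ^ d" by simp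
  then have "real (card N) * (1 / 2) ^ d * 2 ^ d \<le> 3 ^ d * 2 ^ d" by (intro mult_right_mono) auto
  then have "real (card N) \<le> (3 * 2) ^ d"
    by (simp only: mult.assoc flip: power_mult_distrib) simp
  then have "real (card N) \<le> real (6 ^ d)" by simp
  then show ?thesis unfolding N_def P_def of_nat_le_iff .
qed

lemma lip_jet_half:
  assumes "0 < \<beta>" "\<beta> \<le> 1"
  shows "lip_jet s \<beta> (\<lambda>i t. if i = 0 then t / 2 else if i = 1 then 1 / 2 else 0)" (is "lip_jet s \<beta> ?G")
  unfolding lip_jet_def
proof (intro conjI allI ballI impI)
  fix i and x :: real
  have "((\<lambda>t. t / 2) has_vector_derivative 1 / 2) (at x within {-1..1})"
    by (auto intro!: derivative_eq_intros simp flip: has_real_derivative_iff_has_vector_derivative)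
  then show "(?G i has_vector_derivative ?G (Suc i) x) (at x within {-1..1})"
    by (auto intro!: derivative_eq_intros)
  show "\<bar>?G i x\<bar> \<le> 1" if "x \<in> {-1..1}" using that by auto
next
  fix x y :: real assume xy: "x \<in> {-1..1}" "y \<in> {-1..1}"
  have "min 1 \<bar>x - y\<bar> powr 1 \<le> min 1 \<bar>x - y\<bar> powr \<beta>"
    using assms by (intro powr_mono') auto
  then have "min 1 \<bar>x - y\<bar> \<le> min 1 \<bar>x - y\<bar> powr \<beta>" by simp
  moreover have "\<bar>x - y\<bar> \<le> 2 * min 1 \<bar>x - y\<bar>" using xy by (auto simp: min_def)
  moreover have "0 \<le> min 1 \<bar>x - y\<bar> powr \<beta>" by simp
  ultimately have "\<bar>x - y\<bar> / 2 \<le> 2 * min 1 \<bar>x - y\<bar> powr \<beta>" by linarith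
  moreover have "\<bar>x / 2 - y / 2\<bar> = \<bar>x - y\<bar> / 2" by (simp flip: diff_divide_distrib)
  ultimately show "\<bar>?G s x - ?G s y\<bar> \<le> 2 * min 1 \<bar>x - y\<bar> powr \<beta>" by auto
qed

text \<open>The supremum of a linear form is attained at its normalised coefficient vector.\<close>

lemma sup_linear_unit_ball:
  assumes "\<And>x. x \<in> unit_ball d \<Longrightarrow> (\<Sum>i<d. c i * x i) \<le> e"
  shows "L2_set c {..<d} \<le> e"
proof (cases "L2_set c {..<d} = 0")
  case True
  have "(\<lambda>i\<in>{..<d}. 0) \<in> unit_ball d" by (simp add: unit_ball_def L2_set_def)
  from assms[OF this] show ?thesis using True by simp
next
  case False
  define n where "n = L2_set c {..<d}"
  have n: "n > 0" using False unfolding n_def by (simp add: order_less_le)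
  have n2: "n\<^sup>2 = (\<Sum>i<d. (c i)\<^sup>2)" unfolding n_def L2_set_def by (simp add: sum_nonneg)
  define x where "x = (\<lambda>i\<in>{..<d}. (1 / n) * c i)"
  have "L2_set x {..<d} = L2_set (\<lambda>i. (1 / n) * c i) {..<d}" unfolding x_def by (intro L2_set_cong) auto
  then have "x \<in> unit_ball d"
    using n by (simp only: L2_set_scale) (simp add: unit_ball_def x_def n_def)
  then have "(\<Sum>i<d. c i * x i) \<le> e" by (rule assms)
  also have "(\<Sum>i<d. c i * x i) = (1 / n) * n\<^sup>2"
    unfolding n2 sum_distrib_left x_def by (intro sum.cong) (auto simp: power2_eq_square)
  finally show ?thesis using n by (simp add: n_def power2_eq_square)
qed

text \<open>For the linear profile \<open>t / 2\<close> the uniform distance of two ridge functions is half the Euclidean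
  distance of their directions, so the class contains a copy of the Euclidean unit ball. The test family
  is a lattice in the cube inscribed in that ball.\<close>

lemma entropy_ridge_class_ge_dimension:
  assumes \<alpha>: "\<alpha> > 0" and d: "d \<ge> 1" and k: "k \<ge> 1"
  shows "ereal (2 powr (- (real k / real d)) / 16)
           \<le> entropy_number k (ridge_class \<alpha> d) (Linf (ball_measure d)) (Linf_norm (ball_measure d))"
proof -
  define b where "b = 2 powr (real k / real d)"
  \<comment> \<open>The cube has \<open>(2 * q + 1) ^ d\<close> lattice points, more than \<open>6 ^ d\<close> for each of \<open>2 ^ k = b ^ d\<close>
    balls.\<close>
  define q where "q = nat \<lceil>3 * b\<rceil>"
  have b: "b \<ge> 1" unfolding b_def by (intro ge_one_powr_ge_zero) auto
  have q: "3 * b \<le> real q" "real q \<le> 4 * b" using b unfolding q_def by linarith+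
  have q0: "real q > 0" using q b by linarith
  define P where "P = ({..<d} \<rightarrow>\<^sub>E {- int q..int q})"
  define dir where "dir z = (\<lambda>i\<in>{..<d}. of_int (z i) / (real q * sqrt (real d)))" for z :: "nat \<Rightarrow> int"
  define F where "F z = ridge d (\<lambda>t. t / 2) (dir z)" for z
  define near where "near z w \<longleftrightarrow> (\<Sum>i<d. (z i - w i)\<^sup>2) \<le> int d" for z w :: "nat \<Rightarrow> int"
  \<comment> \<open>Functions closer than \<open>2 * \<eta>\<close> have directions closer than \<open>4 * \<eta> = 1 / q\<close>, that is, lattice
    points closer than \<open>sqrt d\<close>.\<close>
  define \<eta> where "\<eta> = 1 / (4 * real q)"
  note \<beta> = lip_order[OF \<alpha>]
  have dir_L2: "L2_set (\<lambda>i. dir z i - dir w i) {..<d} * (real q * sqrt (real d))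
      = sqrt (of_int (\<Sum>i<d. (z i - w i)\<^sup>2))" for z w
  proof -
    define n where "n = real q * sqrt (real d)"
    have n: "n > 0" using q0 d by (simp add: n_def)
    have "L2_set (\<lambda>i. dir z i - dir w i) {..<d} = L2_set (\<lambda>i. (1 / n) * of_int (z i - w i)) {..<d}"
      by (intro L2_set_cong) (auto simp: dir_def n_def diff_divide_distrib)
    also have "\<dots> = (1 / n) * L2_set (\<lambda>i. of_int (z i - w i)) {..<d}" using n by (simp only: L2_set_scale) simp
    also have "L2_set (\<lambda>i. of_int (z i - w i)) {..<d} = sqrt (of_int (\<Sum>i<d. (z i - w i)\<^sup>2))"
      by (simp add: L2_set_def)
    finally show ?thesis unfolding n_def[symmetric] using n by simp
  qed
  have dir_ball: "dir z \<in> unit_ball d" if z: "z \<in> P" for z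
  proof -
    have "(z i)\<^sup>2 \<le> (int q)\<^sup>2" if "i < d" for i
      using PiE_mem[OF z[unfolded P_def], of i] that by (intro abs_le_square_iff[THEN iffD1]) auto
    then have "(\<Sum>i<d. (z i - 0)\<^sup>2) \<le> (\<Sum>i<d. (int q)\<^sup>2)" by (intro sum_mono) auto
    then have "(of_int (\<Sum>i<d. (z i - 0)\<^sup>2) :: real) \<le> of_int (\<Sum>i<d. (int q)\<^sup>2)"
      unfolding of_int_le_iff .
    also have "\<dots> = (real q * sqrt (real d))\<^sup>2" by (simp add: power_mult_distrib mult.commute)
    finally have "sqrt (of_int (\<Sum>i<d. (z i - 0)\<^sup>2)) \<le> real q * sqrt (real d)"
      by (intro real_le_lsqrt) auto
    moreover have "L2_set (\<lambda>i. dir z i - dir (\<lambda>_. 0) i) {..<d} = L2_set (dir z) {..<d}"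
      by (intro L2_set_cong) (auto simp: dir_def)
    ultimately have "L2_set (dir z) {..<d} * (real q * sqrt (real d)) \<le> 1 * (real q * sqrt (real d))"
      using dir_L2[of z "\<lambda>_. 0"] by simp
    then have "L2_set (dir z) {..<d} \<le> 1"
      using q0 d by (subst (asm) mult_le_cancel_right_pos) auto
    then show ?thesis unfolding unit_ball_def by (auto simp: dir_def)
  qed
  have "ereal \<eta> \<le> entropy_number k (ridge_class \<alpha> d) (Linf (ball_measure d)) (Linf_norm (ball_measure d))"
  proof (rule entropy_number_ge_multiplicity[where F=F and I=P and near=near and m="6 ^ d"])
    show "finite P" unfolding P_def by (intro finite_PiE) auto
    have jet: "lip_jet (lip_order \<alpha>) (\<alpha> - lip_order \<alpha>)
        (\<lambda>i t. if i = 0 then t / 2 else if i = 1 then 1 / 2 else 0)"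
      using \<beta> by (intro lip_jet_half) auto
    show "F ` P \<subseteq> ridge_class \<alpha> d"
    proof
      fix f assume "f \<in> F ` P"
      then obtain z where z: "z \<in> P" "f = F z" by auto
      show "f \<in> ridge_class \<alpha> d"
        unfolding ridge_class_eq_jets[OF \<alpha>] z(2) F_def
        using jet dir_ball[OF z(1)]
        by (intro image_eqI[where x="(\<lambda>i t. if i = 0 then t / 2 else if i = 1 then 1 / 2 else 0, dir z)"]) auto
    qed
    show "0 \<le> \<eta>" by (simp add: \<eta>_def)
    show "card {w \<in> P. near z w} \<le> 6 ^ d" if "z \<in> P" for z
      using lattice_points_in_ball[of z d q] that unfolding P_def near_def by simp
    have card_P: "card P = (2 * q + 1) ^ d"
    proof -
      have "card {- int q..int q} = 2 * q + 1" by simp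
      then show ?thesis
        unfolding P_def by (simp only: card_PiE[OF finite_lessThan] prod_constant card_lessThan)
    qed
    have "real (2 ^ (k - 1) * 6 ^ d) < real ((2 * q + 1) ^ d)"
    proof -
      have "real (2 ^ (k - 1) * 6 ^ d) < 2 ^ k * 6 ^ d" using k by (simp add: power_strict_increasing)
      also have "(2::real) ^ k = b ^ d"
        using d by (simp add: b_def powr_realpow[symmetric] powr_powr)
      also have "b ^ d * 6 ^ d = (6 * b) ^ d" by (simp add: power_mult_distrib mult.commute)
      also have "\<dots> \<le> (2 * real q + 1) ^ d" using q b by (intro power_mono) auto
      finally show ?thesis by (simp add: add.commute)
    qed
    then show "2 ^ (k - 1) * 6 ^ d < card P" unfolding card_P of_nat_less_iff .
    fix z w \<epsilon>
    assume z: "z \<in> P" and w: "w \<in> P" and \<epsilon>: "\<epsilon> < \<eta>"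
      and AE: "AE x in ball_measure d. \<bar>F z x - F w x\<bar> \<le> 2 * \<epsilon>"
    have "L2_set (\<lambda>i. dir z i - dir w i) {..<d} \<le> 4 * \<epsilon>"
    proof (rule sup_linear_unit_ball)
      fix x assume x: "x \<in> unit_ball d"
      have "\<bar>F z x - F w x\<bar> \<le> 2 * \<epsilon>"
        unfolding F_def by (rule ridge_AE_close[OF AE[unfolded F_def] _ _ dir_ball[OF z] dir_ball[OF w] x])
          (auto intro!: continuous_intros)
      moreover have "F z x - F w x = (\<Sum>i<d. (dir z i - dir w i) * x i) / 2"
        using x by (simp add: F_def ridge_def sum_subtractf left_diff_distrib diff_divide_distrib)
      ultimately show "(\<Sum>i<d. (dir z i - dir w i) * x i) \<le> 4 * \<epsilon>" by (simp add: abs_le_iff)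
    qed
    also have "4 * \<epsilon> \<le> 1 / real q" using \<epsilon> by (simp add: \<eta>_def)
    finally have "sqrt (of_int (\<Sum>i<d. (z i - w i)\<^sup>2)) \<le> 1 / real q * (real q * sqrt (real d))"
      unfolding dir_L2[symmetric] by (intro mult_right_mono) auto
    then have "of_int (\<Sum>i<d. (z i - w i)\<^sup>2) \<le> (of_int (int d) :: real)" using q0 by simp
    then show "near z w" unfolding near_def of_int_le_iff .
  qed
  moreover have "2 powr (- (real k / real d)) / 16 \<le> \<eta>"
    using q b unfolding \<eta>_def powr_minus b_def[symmetric] by (simp add: field_simps)
  ultimately show ?thesis by (meson ereal_less_eq(3) order_trans)
qed

section \<open>The lower bound by varying the profile\<close>

text \<open>If \<open>q\<close> vanishes at a point, then so do the first \<open>n - 1\<close> derivatives of \<open>q ^ n\<close>; hence a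
  function that equals \<open>q ^ n\<close> between two zeros of \<open>q\<close>, and zero elsewhere, is \<open>n - 1\<close> times
  differentiable.\<close>

lemma higher_pderiv_power_dvd:
  fixes q :: "real poly"
  assumes "i \<le> n"
  shows "q ^ (n - i) dvd (pderiv ^^ i) (q ^ n)"
  using assms
proof (induction i)
  case (Suc i)
  then obtain r where "(pderiv ^^ i) (q ^ n) = q ^ Suc (n - Suc i) * r"
    by (metis Suc_diff_le Suc_leD diff_Suc_Suc dvdE)
  then have "(pderiv ^^ Suc i) (q ^ n) = pderiv (q ^ Suc (n - Suc i) * r)" by simp
  also have "\<dots> = q ^ Suc (n - Suc i) * pderiv r + r * (smult (of_nat (Suc (n - Suc i))) (q ^ (n - Suc i)) * pderiv q)"
    by (simp only: pderiv_mult pderiv_power_Suc)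
  also have "\<dots> = q ^ (n - Suc i) * (q * pderiv r + r * (smult (of_nat (Suc (n - Suc i))) (pderiv q)))"
    by (simp add: algebra_simps)
  finally show ?case by simp
qed simp

text \<open>As with jets, \<open>\<Phi> i\<close> is the derivative of order \<open>i\<close>. One derivative more than the order
  \<open>s\<close> of the jet is controlled, for the sake of the Hoelder condition.\<close>

definition smooth_bump :: "nat \<Rightarrow> (nat \<Rightarrow> real \<Rightarrow> real) \<Rightarrow> bool" where
  "smooth_bump s \<Phi> \<longleftrightarrow> \<Phi> 0 (1 / 2) > 0 \<and> (\<forall>i\<le>Suc s. \<forall>t. \<bar>\<Phi> i t\<bar> \<le> 1) \<and>
     (\<forall>i\<le>Suc s. \<forall>t. t \<notin> {0<..<1} \<longrightarrow> \<Phi> i t = 0) \<and>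
     (\<forall>i\<le>s. \<forall>t. (\<Phi> i has_vector_derivative \<Phi> (Suc i) t) (at t))"

text \<open>The bump is a normalised power of \<open>t * (1 - t)\<close> on the unit interval.\<close>

lemma smooth_bump_exists: "\<exists>\<Phi>. smooth_bump s \<Phi>"
proof -
  define n where "n = s + 2"
  define q :: "real poly" where "q = [:0, 1, -1:]"
  define p where "p i = (pderiv ^^ i) (q ^ n)" for i
  define \<Psi> where "\<Psi> i t = (if t \<in> {0..1} then poly (p i) t else 0)" for i t
  have p0: "poly (p i) 0 = 0" "poly (p i) 1 = 0" if "i \<le> Suc s" for i
  proof -
    have "q ^ (n - i) dvd p i" unfolding p_def by (rule higher_pderiv_power_dvd) (use that n_def in simp)
    moreover have "q dvd q ^ (n - i)" using that by (intro dvd_power) (simp add: n_def)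
    ultimately have "q dvd p i" by (rule dvd_trans[rotated])
    then show "poly (p i) 0 = 0" "poly (p i) 1 = 0" by (auto simp: q_def elim!: dvdE)
  qed
  have deriv: "(\<Psi> i has_vector_derivative \<Psi> (Suc i) t) (at t)" if "i \<le> s" for i t
  proof -
    have cl: "closure (- {0..1 :: real}) = - {0<..<1}"
      by (simp add: closure_complement)
    have bd: "x = 0 \<or> x = 1" if "x \<in> {0..1}" "x \<notin> {0<..<1}" for x :: real using that by auto
    have "((\<lambda>x. if x \<in> {0..1} then poly (p i) x else 0) has_vector_derivative
        (if t \<in> {0..1} then poly (p (Suc i)) t else 0)) (at t within UNIV)"
    proof (rule has_vector_derivative_If_within_closures[where T="- {0..1}"])
      have "(poly (p i) has_real_derivative poly (p (Suc i)) t) (at t)"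
        using poly_DERIV[of "p i" t] by (simp add: p_def)
      then show "(poly (p i) has_vector_derivative poly (p (Suc i)) t)
          (at t within {0..1} \<union> (closure {0..1} \<inter> closure (- {0..1})))"
        by (simp add: has_real_derivative_iff_has_vector_derivative has_vector_derivative_at_within)
      show "poly (p i) t = 0" "poly (p (Suc i)) t = 0"
        if "t \<in> closure {0..1}" "t \<in> closure (- {0..1})"
        using p0[of i] p0[of "Suc i"] \<open>i \<le> s\<close> bd[of t] that unfolding cl by auto
    qed auto
    then show ?thesis unfolding \<Psi>_def[abs_def] by simp
  qed
  have "\<exists>M. \<forall>i\<le>Suc s. \<forall>t. \<bar>\<Psi> i t\<bar> \<le> M"
  proof -
    have "bounded (\<Union>i\<in>{..Suc s}. poly (p i) ` {0..1})"
      by (intro bounded_UN ballI compact_imp_bounded compact_continuous_image continuous_intros) auto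
    then obtain M where M: "\<And>i t. i \<le> Suc s \<Longrightarrow> t \<in> {0..1} \<Longrightarrow> \<bar>poly (p i) t\<bar> \<le> M"
      unfolding bounded_iff by fastforce
    have "\<bar>\<Psi> i t\<bar> \<le> \<bar>M\<bar>" if "i \<le> Suc s" for i t
      using M[OF that, of t] by (auto simp: \<Psi>_def)
    then show ?thesis by auto
  qed
  then obtain M where M: "\<And>i t. i \<le> Suc s \<Longrightarrow> \<bar>\<Psi> i t\<bar> \<le> M" by auto
  have half: "\<Psi> 0 (1 / 2) = (1 / 4) ^ n" by (simp add: \<Psi>_def p_def q_def poly_power)
  have "(0::real) < (1 / 4) ^ n" by simp
  also have "\<dots> \<le> M" using M[of 0 "1 / 2"] half by simp
  finally have M0: "M > 0" .
  show ?thesis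
    unfolding smooth_bump_def
  proof (intro exI[of _ "\<lambda>i t. \<Psi> i t / M"] conjI allI impI)
    show "\<Psi> 0 (1 / 2) / M > 0" using M0 half by simp
    show "\<bar>\<Psi> i t / M\<bar> \<le> 1" if "i \<le> Suc s" for i t using M[OF that, of t] M0 by simp
    show "\<Psi> i t / M = 0" if "i \<le> Suc s" "t \<notin> {0<..<1}" for i t
      using p0[OF that(1)] that(2) by (cases "t = 0"; cases "t = 1") (auto simp: \<Psi>_def)
    show "((\<lambda>t. \<Psi> i t / M) has_vector_derivative \<Psi> (Suc i) t / M) (at t)" if "i \<le> s" for i t
      using deriv[OF that, of t] unfolding has_real_derivative_iff_has_vector_derivative[symmetric]
      by (rule DERIV_cdivide)
  qed
qed

text \<open>The derivative of order \<open>i\<close> of a sum of translated bumps of width \<open>1 / k\<close> and height of the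
  order \<open>k powr (- \<alpha>)\<close>, one for each \<open>j \<in> A\<close>, side by side from \<open>-1\<close> on.\<close>

definition bump_sum ::
  "(nat \<Rightarrow> real \<Rightarrow> real) \<Rightarrow> real \<Rightarrow> nat \<Rightarrow> nat set \<Rightarrow> nat \<Rightarrow> real \<Rightarrow> real" where
  "bump_sum \<Phi> \<alpha> k A i x = (1 / real k) powr (\<alpha> - i) * (\<Sum>j\<in>A. \<Phi> i (real k * (x + 1) - real j))"

text \<open>The supports have disjoint interiors, so the whole sum obeys the bound of a single bump.\<close>

lemma bump_sum_bound:
  assumes A: "finite A" and k: "k > 0" and bd: "\<And>t. \<bar>\<Phi> i t\<bar> \<le> 1"
    and supp: "\<And>t. t \<notin> {0<..<1} \<Longrightarrow> \<Phi> i t = 0"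
  shows "\<bar>bump_sum \<Phi> \<alpha> k A i x\<bar> \<le> (1 / real k) powr (\<alpha> - i)"
proof -
  define z where "z = real k * (x + 1)"
  have "(\<Sum>j\<in>A. \<Phi> i (z - real j)) = (\<Sum>j\<in>A \<inter> {nat \<lfloor>z\<rfloor>}. \<Phi> i (z - real j))"
  proof (rule sum.mono_neutral_right[OF A])
    show "\<forall>j\<in>A - A \<inter> {nat \<lfloor>z\<rfloor>}. \<Phi> i (z - real j) = 0"
    proof
      fix j assume "j \<in> A - A \<inter> {nat \<lfloor>z\<rfloor>}"
      then have "j \<noteq> nat \<lfloor>z\<rfloor>" by auto
      then have "z - real j \<notin> {0<..<1}" by (auto; linarith)
      then show "\<Phi> i (z - real j) = 0" by (rule supp)
    qed
  qed auto
  then have "\<bar>\<Sum>j\<in>A. \<Phi> i (z - real j)\<bar> \<le> 1"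
    using bd by (cases "nat \<lfloor>z\<rfloor> \<in> A") auto
  then show ?thesis
    unfolding bump_sum_def z_def[symmetric] by (simp add: abs_mult mult_left_le)
qed

text \<open>The Hoelder condition follows from the bound on the derivative of order \<open>s\<close> for points at
  distance at least \<open>1 / k\<close>, and from the bound on the derivative of order \<open>s + 1\<close> for closer
  points.\<close>

lemma lip_jet_bump_sum:
  assumes A: "finite A" and k: "k > 0" and \<beta>: "0 < \<beta>" "\<beta> \<le> 1"
    and bump: "smooth_bump s \<Phi>"
  shows "lip_jet s \<beta> (bump_sum \<Phi> (s + \<beta>) k A)"
proof -
  have bd: "\<bar>\<Phi> i t\<bar> \<le> 1" if "i \<le> Suc s" for i t
    using bump that unfolding smooth_bump_def by blast
  have supp: "\<Phi> i t = 0" if "i \<le> Suc s" "t \<notin> {0<..<1}" for i t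
    using bump that unfolding smooth_bump_def by blast
  have deriv: "(\<Phi> i has_vector_derivative \<Phi> (Suc i) t) (at t)" if "i \<le> s" for i t
    using bump that unfolding smooth_bump_def by blast
  define \<delta> where "\<delta> = 1 / real k"
  have \<delta>: "0 < \<delta>" "\<delta> \<le> 1" using k by (auto simp: \<delta>_def)
  define F where "F = bump_sum \<Phi> (s + \<beta>) k A"
  have F_bd: "\<bar>F i x\<bar> \<le> \<delta> powr (s + \<beta> - i)" if "i \<le> Suc s" for i x
    unfolding F_def \<delta>_def using bd[OF that] supp[OF that] by (rule bump_sum_bound[OF A k])
  have F_deriv: "(F i has_real_derivative F (Suc i) x) (at x)" if "i \<le> s" for i x
  proof -
    have "((\<lambda>x. \<Phi> i (real k * (x + 1) - real j)) has_real_derivative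
        \<Phi> (Suc i) (real k * (x + 1) - real j) * real k) (at x)" for j
    proof (rule DERIV_chain2[where f="\<Phi> i"])
      show "(\<Phi> i has_real_derivative \<Phi> (Suc i) (real k * (x + 1) - real j)) (at (real k * (x + 1) - real j))"
        using deriv[OF that] by (simp add: has_real_derivative_iff_has_vector_derivative)
      show "((\<lambda>x. real k * (x + 1) - real j) has_real_derivative real k) (at x)"
        by (rule derivative_eq_intros refl | simp)+
    qed
    then have "((\<lambda>x. \<Sum>j\<in>A. \<Phi> i (real k * (x + 1) - real j)) has_real_derivative
        (\<Sum>j\<in>A. \<Phi> (Suc i) (real k * (x + 1) - real j) * real k)) (at x)"
      by (rule DERIV_sum)
    then have "(F i has_real_derivative \<delta> powr (s + \<beta> - i) *
        (\<Sum>j\<in>A. \<Phi> (Suc i) (real k * (x + 1) - real j) * real k)) (at x)"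
      unfolding F_def bump_sum_def[abs_def] \<delta>_def by (rule DERIV_cmult)
    moreover have "\<delta> powr (s + \<beta> - i) = \<delta> powr (s + \<beta> - Suc i) * (1 / real k)"
      using \<delta> powr_add[of \<delta> "s + \<beta> - Suc i" 1] by (simp add: \<delta>_def add_diff_eq)
    ultimately have "(F i has_real_derivative \<delta> powr (s + \<beta> - Suc i) * (1 / real k) *
        ((\<Sum>j\<in>A. \<Phi> (Suc i) (real k * (x + 1) - real j)) * real k)) (at x)"
      by (simp only: sum_distrib_right)
    moreover have "\<delta> powr (s + \<beta> - Suc i) * (1 / real k) *
        ((\<Sum>j\<in>A. \<Phi> (Suc i) (real k * (x + 1) - real j)) * real k) = F (Suc i) x"
      using k by (simp add: F_def bump_sum_def \<delta>_def)
    ultimately show ?thesis by simp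
  qed
  have "\<bar>F s x - F s y\<bar> \<le> 2 * min 1 \<bar>x - y\<bar> powr \<beta>" for x y
  proof (cases "\<bar>x - y\<bar> \<ge> \<delta>")
    case True
    have "\<bar>F s x - F s y\<bar> \<le> 2 * \<delta> powr \<beta>"
      using F_bd[of s x] F_bd[of s y] by simp
    also have "\<dots> \<le> 2 * min 1 \<bar>x - y\<bar> powr \<beta>"
      using True \<delta> \<beta> by (intro mult_left_mono powr_mono2) auto
    finally show ?thesis .
  next
    case False
    define r where "r = \<bar>x - y\<bar>"
    show ?thesis
    proof (cases "x = y")
      case False
      have r: "0 < r" "r < \<delta>" using False \<open>\<not> \<delta> \<le> \<bar>x - y\<bar>\<close> by (auto simp: r_def)
      have "\<bar>F s x - F s y\<bar> \<le> \<delta> powr (\<beta> - 1) * r"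
        using field_differentiable_bound[of UNIV "F s" "F (Suc s)" "\<delta> powr (\<beta> - 1)" x y]
          F_deriv[of s] F_bd[of "Suc s"] by (auto simp: r_def)
      also have "\<dots> \<le> r powr (\<beta> - 1) * r"
        using r \<beta> by (intro mult_right_mono powr_mono2') auto
      also have "\<dots> = r powr \<beta>" using r powr_add[of r "\<beta> - 1" 1] by simp
      also have "\<dots> \<le> 2 * min 1 r powr \<beta>" using r \<delta> by (simp add: min_def)
      finally show ?thesis by (simp add: r_def)
    qed simp
  qed
  moreover have "\<bar>F i x\<bar> \<le> 1" if "i \<le> s" for i x
  proof -
    have "\<delta> powr (s + \<beta> - i) \<le> 1" using \<delta> \<beta> that by (intro powr_le1) auto
    then show ?thesis using F_bd[of i x] that by linarith
  qed
  ultimately show ?thesis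
    unfolding lip_jet_def F_def[symmetric]
    using F_deriv unfolding has_real_derivative_iff_has_vector_derivative
    by (blast intro: has_vector_derivative_at_within less_imp_le)
qed

text \<open>The \<open>2 ^ k\<close> sums of bumps indexed by the subsets of \<open>{..<k}\<close>, composed with the first
  coordinate, are too many for \<open>2 ^ (k - 1)\<close> balls with at most one of them in each. Two of them
  differ by the full height of a bump in the middle of its support.\<close>

lemma entropy_ridge_class_ge_smoothness:
  assumes \<alpha>: "\<alpha> > 0"
  shows "\<exists>A>0. \<forall>d k :: nat. d \<ge> 1 \<longrightarrow> k \<ge> 1 \<longrightarrow>
           ereal (A * real k powr (- \<alpha>))
             \<le> entropy_number k (ridge_class \<alpha> d) (Linf (ball_measure d)) (Linf_norm (ball_measure d))"
proof -
  define s where "s = lip_order \<alpha>"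
  define \<beta> where "\<beta> = \<alpha> - s"
  have \<beta>: "0 < \<beta>" "\<beta> \<le> 1" "s + \<beta> = \<alpha>" using lip_order[OF \<alpha>] by (auto simp: \<beta>_def s_def)
  obtain \<Phi> where bump: "smooth_bump s \<Phi>" using smooth_bump_exists by blast
  define h where "h = \<Phi> 0 (1 / 2)"
  have h: "h > 0" "\<Phi> 0 (1 / 2) = h" using bump by (simp_all add: h_def smooth_bump_def)
  have supp: "\<Phi> 0 t = 0" if "t \<notin> {0<..<1}" for t
    using bump that unfolding smooth_bump_def by blast
  have "ereal (h / 2 * real k powr (- \<alpha>))
      \<le> entropy_number k (ridge_class \<alpha> d) (Linf (ball_measure d)) (Linf_norm (ball_measure d))"
    if d: "d \<ge> 1" and k: "k \<ge> 1" for d k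
  proof -
    \<comment> \<open>The points of the first coordinate axis; \<open>ray 1\<close> serves as direction.\<close>
    define ray where "ray t = (\<lambda>i\<in>{..<d}. if i = 0 then t else 0)" for t :: real
    have ray_inner: "(\<Sum>i<d. ray 1 i * ray t i) = t" for t
    proof -
      have "(\<Sum>i<d. ray 1 i * ray t i) = (\<Sum>i<d. if i = 0 then t else 0)"
        by (intro sum.cong) (auto simp: ray_def)
      then show ?thesis using d by simp
    qed
    have ray_ball: "ray t \<in> unit_ball d" if "\<bar>t\<bar> \<le> 1" for t
    proof -
      have "(\<Sum>i<d. (ray t i)\<^sup>2) = (\<Sum>i<d. if i = 0 then t\<^sup>2 else 0)"
        by (intro sum.cong) (auto simp: ray_def)
      also have "\<dots> \<le> 1" using d that by (simp add: abs_square_le_1)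
      finally show ?thesis by (simp add: unit_ball_def L2_set_def ray_def)
    qed
    define G where "G A = bump_sum \<Phi> \<alpha> k A" for A
    have jet: "lip_jet s \<beta> (G A)" if "finite A" for A
      using lip_jet_bump_sum[OF that _ \<beta>(1,2) bump, of k] k \<beta>(3) by (simp add: G_def)
    define F where "F A = ridge d (G A 0) (ray 1)" for A
    show ?thesis
    proof (rule entropy_number_ge_multiplicity[where F=F and I="Pow {..<k}" and near="(=)" and m=1])
      show "F ` Pow {..<k} \<subseteq> ridge_class \<alpha> d"
      proof
        fix f assume "f \<in> F ` Pow {..<k}"
        then obtain A where A: "A \<subseteq> {..<k}" "f = F A" by auto
        have "finite A" using A(1) finite_subset by blast
        then show "f \<in> ridge_class \<alpha> d"
          unfolding ridge_class_eq_jets[OF \<alpha>] A(2) F_def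
          using jet ray_ball[of 1] unfolding \<beta>_def s_def
          by (intro image_eqI[where x="(G A, ray 1)"]) auto
      qed
      show "0 \<le> h / 2 * real k powr (- \<alpha>)" using h by simp
      show "card {B \<in> Pow {..<k}. A = B} \<le> 1" for A
        using card_mono[of "{A}" "{B \<in> Pow {..<k}. A = B}"] by auto
      show "2 ^ (k - 1) * 1 < card (Pow {..<k})" using k by (simp add: card_Pow power_strict_increasing)
      fix A B \<epsilon>
      assume AB: "A \<in> Pow {..<k}" "B \<in> Pow {..<k}" and \<epsilon>: "\<epsilon> < h / 2 * real k powr (- \<alpha>)"
        and AE: "AE x in ball_measure d. \<bar>F A x - F B x\<bar> \<le> 2 * \<epsilon>"
      have fin: "finite A" "finite B" using AB finite_subset by auto
      show "A = B"
      proof (rule ccontr)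
        assume "A \<noteq> B"
        then obtain j where j: "(j \<in> A) \<noteq> (j \<in> B)" by blast
        then have jk: "j < k" using AB by auto
        \<comment> \<open>The midpoint of the support of the bump number \<open>j\<close>.\<close>
        define t where "t = -1 + (real j + 1 / 2) / real k"
        have "(real j + 1 / 2) / real k \<le> 1" using jk by simp
        then have t: "\<bar>t\<bar> \<le> 1" unfolding t_def by (simp add: abs_le_iff)
        have kt: "real k * (t + 1) = real j + 1 / 2" using k by (simp add: t_def)
        have val: "G C 0 t = (if j \<in> C then real k powr (- \<alpha>) * h else 0)" if "finite C" for C
        proof -
          have "(\<Sum>i\<in>C. \<Phi> 0 (real j + 1 / 2 - real i)) = (\<Sum>i\<in>C. if i = j then h else 0)"
          proof (rule sum.cong)
            fix i
            have "real j + 1 / 2 - real i \<notin> {0<..<1}" if "i \<noteq> j"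
              using that by (cases "i < j") (auto simp flip: of_nat_Suc)
            then show "\<Phi> 0 (real j + 1 / 2 - real i) = (if i = j then h else 0)"
              using supp h(2) by auto
          qed simp
          also have "\<dots> = (if j \<in> C then h else 0)" using that by simp
          finally show ?thesis using k by (simp add: G_def bump_sum_def kt powr_divide powr_minus_divide)
        qed
        have "\<bar>F A (ray t) - F B (ray t)\<bar> \<le> 2 * \<epsilon>"
          unfolding F_def
          using jet_continuous[OF jet \<beta>(1), of _ 0] fin ray_ball[of 1] ray_ball[OF t]
          by (intro ridge_AE_close[OF AE[unfolded F_def]]) auto
        moreover have "F A (ray t) - F B (ray t) = G A 0 t - G B 0 t"
          using ray_ball[OF t] by (simp add: F_def ridge_def ray_inner)
        moreover have "\<bar>G A 0 t - G B 0 t\<bar> = real k powr (- \<alpha>) * h"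
          using j h val[OF fin(1)] val[OF fin(2)] by (auto simp: abs_mult)
        ultimately show False using \<epsilon> by (simp add: mult.commute)
      qed
    qed simp
  qed
  then show ?thesis using h by (intro exI[of _ "h / 2"]) auto
qed

theorem corollary3p6:
  fixes \<alpha> :: real
  assumes "\<alpha> > 0"
  shows "\<exists>c A B' :: real. c > 0 \<and> A > 0 \<and> B' > 0 \<and>
    (\<forall>d k :: nat. d \<ge> 1 \<longrightarrow> k \<ge> 1 \<longrightarrow>
      (let e = entropy_number k (ridge_class \<alpha> d)
                 (Linf (ball_measure d)) (Linf_norm (ball_measure d))
       in ereal (A * max (real k powr (- \<alpha>)) (2 powr (- (real k / real d)))) \<le> e \<and>
          (real k \<le> c * real d * log 2 (real d) \<longrightarrow> e \<le> ereal B') \<and>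
          (real k \<ge> c * real d * log 2 (real d) \<longrightarrow> e \<le> ereal (B' * real k powr (- \<alpha>)))))"
proof -
  obtain c B where c: "c > 0" "B \<ge> 2" and upper: "\<And>d k :: nat. d \<ge> 1 \<Longrightarrow> k \<ge> 1 \<Longrightarrow>
      real k \<ge> c * real d * log 2 (real d) \<Longrightarrow>
      entropy_number k (ridge_class \<alpha> d) (Linf (ball_measure d)) (Linf_norm (ball_measure d))
        \<le> ereal (B * real k powr (- \<alpha>))"
    using entropy_ridge_class_upper[OF assms] by blast
  obtain A where A: "A > 0" and lower: "\<And>d k :: nat. d \<ge> 1 \<Longrightarrow> k \<ge> 1 \<Longrightarrow>
      ereal (A * real k powr (- \<alpha>))
        \<le> entropy_number k (ridge_class \<alpha> d) (Linf (ball_measure d)) (Linf_norm (ball_measure d))"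
    using entropy_ridge_class_ge_smoothness[OF assms] by blast
  define A' where "A' = min A (1 / 16)"
  have A': "A' > 0" "A' \<le> A" "A' \<le> 1 / 16" using A by (auto simp: A'_def)
  have lower': "ereal (A' * max (real k powr (- \<alpha>)) (2 powr (- (real k / real d))))
      \<le> entropy_number k (ridge_class \<alpha> d) (Linf (ball_measure d)) (Linf_norm (ball_measure d))"
    if "d \<ge> 1" "k \<ge> 1" for d k :: nat
  proof -
    have "A' * max (real k powr (- \<alpha>)) (2 powr (- (real k / real d)))
        \<le> max (A * real k powr (- \<alpha>)) (2 powr (- (real k / real d)) / 16)"
      using mult_right_mono[OF A'(2), of "real k powr (- \<alpha>)"]
        mult_right_mono[OF A'(3), of "2 powr (- (real k / real d))"]
      by (cases "real k powr (- \<alpha>) \<le> 2 powr (- (real k / real d))")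
        (simp_all add: max_absorb1 max_absorb2 le_max_iff_disj)
    then have "ereal (A' * max (real k powr (- \<alpha>)) (2 powr (- (real k / real d))))
        \<le> max (ereal (A * real k powr (- \<alpha>))) (ereal (2 powr (- (real k / real d)) / 16))"
      by (simp add: max_def split: if_splits)
    also have "\<dots> \<le> entropy_number k (ridge_class \<alpha> d) (Linf (ball_measure d)) (Linf_norm (ball_measure d))"
      using lower[OF that] entropy_ridge_class_ge_dimension[OF assms that] by simp
    finally show ?thesis .
  qed
  have "entropy_number k (ridge_class \<alpha> d) (Linf (ball_measure d)) (Linf_norm (ball_measure d)) \<le> ereal B"
    for d k
    using entropy_ridge_class_le_2[OF assms, of k d] c(2)
    by (meson ereal_less_eq(3) order_trans)
  then show ?thesis
    unfolding Let_def using c A'(1) lower' upper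
    by (intro exI[of _ c] exI[of _ A'] exI[of _ B]) auto
qed

end
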